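(* Let $V$ be a homogeneous potential of degree $k=-2$ in $n$ complex variables which has a proper Darboux point $d$. Then, for each integer $p\ge 1$, the differential Galois group of the higher variational equations $\mathrm{VE}_p$ along the phase curve associated with $d$ is Abelian.
   Context: A homogeneous potential $V$ of degree $k$ is a complex function homogeneous of degree $k$, holomorphic on a connected open subset $U\subset\mathbb{C}^n$ stable under multiplication by $\mathbb{C}\setminus\{0\}$. $V'=\operatorname{grad}V$. A proper Darboux point of $V$ is a non-zero vector $d\in U$ with $V'(d)=\gamma d$ for some $\gamma\in\mathbb{C}\setminus\{0\}$. The Hamiltonian system of $H=\frac12\sum p_i^2+V(q)$ is equivalent to the Newton equations $\ddot q=F(q)$, $F=-V'$. It has particular solutions $q_0(t)=\varphi(t)d$, $p_0(t)=\dot\varphi(t)d$, where $\varphi$ satisfies $\ddot\varphi=-\gamma\varphi^{k-1}$ and $\frac12\dot\varphi^2+\frac{\gamma}{k}\varphi^k=e$ for a fixed energy $e\in\mathbb{C}$; the corresponding curve in phase space is the phase curve associated with $d$ (for the arbitrary fixed value $e$). Substituting $q=q_0+\varepsilon q_1+\frac{1}{2!}\varepsilon^2q_2+\frac1{3!}\varepsilon^3q_3+\cdots$ ($\varepsilon$ a formal parameter) into $\ddot q=F(q)$ and comparing coefficients of powers of $\varepsilon$ gives a chain of equations for $q_1,q_2,\dots$: $\ddot q_1=F'(q_0)q_1$, $\ddot q_2=F'(q_0)q_2+F''(q_0)(q_1,q_1)$, $\ddot q_3=F'(q_0)q_3+3F''(q_0)(q_1,q_2)+F^{(3)}(q_0)(q_1,q_1,q_1)$,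 etc. $\mathrm{VE}_p$ denotes the system formed by the first $p$ equations of this chain. The ground differential field is $K=\mathbb{C}(\varphi,\dot\varphi)$. The Picard-Vessiot extension $\mathrm{PV}(\mathrm{VE}_p)/K$ is the differential field extension, with field of constants $\mathbb{C}$, generated over $K$ by the components of all solutions $(q_1,\dots,q_p)$ of these equations, and the differential Galois group of $\mathrm{VE}_p$ is the group of differential $K$-automorphisms of $\mathrm{PV}(\mathrm{VE}_p)$. *)

theory Defs
  imports "HOL-Complex_Analysis.Complex_Analysis" "HOL-Algebra.Bij"
begin

section \<open>Homogeneous potentials and Darboux points\<close>

text \<open>
  Holomorphy in several variables: the Frechet derivative exists at every point and is
  complex linear. The type \<open>complex ^ 'n\<close> is only a real normed space in the library, so complex
  linearity has to be asked for.
\<close>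

definition holomorphic_several :: "(complex ^ 'n \<Rightarrow> complex) \<Rightarrow> (complex ^ 'n) set \<Rightarrow> bool" where
  "holomorphic_several V U \<longleftrightarrow>
     (\<forall>q\<in>U. \<exists>L. (V has_derivative L) (at q) \<and> (\<forall>c v. L (c *s v) = c * L v))"

definition homogeneous_potential ::
    "int \<Rightarrow> (complex ^ 'n) set \<Rightarrow> (complex ^ 'n \<Rightarrow> complex) \<Rightarrow> bool" where
  "homogeneous_potential k U V \<longleftrightarrow>
     open U \<and> connected U \<and> (\<forall>c q. c \<noteq> 0 \<longrightarrow> q \<in> U \<longrightarrow> c *s q \<in> U) \<and>
     holomorphic_several V U \<and>
     (\<forall>c q. c \<noteq> 0 \<longrightarrow> q \<in> U \<longrightarrow> V (c *s q) = c powi k * V q)"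

definition grad :: "(complex ^ 'n \<Rightarrow> complex) \<Rightarrow> complex ^ 'n \<Rightarrow> complex ^ 'n" where
  "grad V q = (\<chi> i. frechet_derivative V (at q) (axis i 1))"

definition proper_darboux_point ::
    "(complex ^ 'n) set \<Rightarrow> (complex ^ 'n \<Rightarrow> complex) \<Rightarrow> complex \<Rightarrow> complex ^ 'n \<Rightarrow> bool" where
  "proper_darboux_point U V \<gamma> d \<longleftrightarrow> d \<in> U \<and> d \<noteq> 0 \<and> \<gamma> \<noteq> 0 \<and> grad V d = \<gamma> *s d"

definition force :: "(complex ^ 'n \<Rightarrow> complex) \<Rightarrow> complex ^ 'n \<Rightarrow> complex ^ 'n" where
  "force V q = - grad V q"

section \<open>The phase curve and the higher variational equations\<close>

text \<open>
  The function \<open>\<phi>\<close> of complex time, on a domain \<open>T\<close>. It does not vanish on \<open>T\<close>, so that the particular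
  solution \<open>\<phi> t *s d\<close> stays in \<open>U\<close> and the powers of \<open>\<phi>\<close> have their usual meaning
  (\<open>0 powi k = 0\<close> for negative \<open>k\<close> in the library).
\<close>

definition phase_curve_function ::
    "int \<Rightarrow> complex \<Rightarrow> complex \<Rightarrow> complex set \<Rightarrow> (complex \<Rightarrow> complex) \<Rightarrow> bool" where
  "phase_curve_function k \<gamma> e T \<phi> \<longleftrightarrow>
     open T \<and> connected T \<and> \<phi> holomorphic_on T \<and>
     (\<forall>t\<in>T. \<phi> t \<noteq> 0 \<and>
        deriv (deriv \<phi>) t = - \<gamma> * \<phi> t powi (k - 1) \<and>
        (deriv \<phi> t)\<^sup>2 / 2 + \<gamma> / of_int k * \<phi> t powi k = e)"

text \<open>
  The right-hand side of the \<open>j\<close>-th equation, at time \<open>t\<close>: since the left-hand side contributes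
  \<open>q\<^sub>j'' / j!\<close>, it is \<open>j!\<close> times the coefficient of \<open>\<epsilon>\<^sup>j\<close> in
  \<open>F (q\<^sub>0 + \<epsilon> q\<^sub>1 + \<dots> + \<epsilon>\<^sup>p q\<^sub>p / p!)\<close>, that is, the \<open>j\<close>-th derivative of this function
  of \<open>\<epsilon>\<close> at \<open>0\<close>. For \<open>j = 1, 2\<close> this gives \<open>F'(q\<^sub>0) q\<^sub>1\<close> and \<open>F'(q\<^sub>0) q\<^sub>2 + F''(q\<^sub>0) (q\<^sub>1, q\<^sub>1)\<close>.
  Terms of order above \<open>j\<close> in the argument do not matter, so the truncation at \<open>p \<ge> j\<close> is harmless.
\<close>

definition variational_rhs ::
    "(complex ^ 'n \<Rightarrow> complex ^ 'n) \<Rightarrow> (complex \<Rightarrow> complex ^ 'n) \<Rightarrow> nat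
      \<Rightarrow> (nat \<Rightarrow> complex \<Rightarrow> complex ^ 'n) \<Rightarrow> nat \<Rightarrow> complex \<Rightarrow> complex ^ 'n" where
  "variational_rhs F q0 p q j t =
     (\<chi> i. (deriv ^^ j) (\<lambda>\<epsilon>. F (q0 t + (\<Sum>m=1..p. (\<epsilon> ^ m / fact m) *s q m t)) $ i) 0)"

text \<open>
  \<open>(q 1, \<dots>, q p)\<close> is a germ at \<open>t0\<close> of a holomorphic solution of the first \<open>p\<close> equations; the other
  values of \<open>q\<close> are irrelevant.
\<close>

definition VE_solution ::
    "(complex ^ 'n \<Rightarrow> complex ^ 'n) \<Rightarrow> (complex \<Rightarrow> complex ^ 'n) \<Rightarrow> nat
      \<Rightarrow> complex \<Rightarrow> (nat \<Rightarrow> complex \<Rightarrow> complex ^ 'n) \<Rightarrow> bool" where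
  "VE_solution F q0 p t0 q \<longleftrightarrow>
     (\<forall>j\<in>{1..p}. \<forall>i.
        (\<lambda>t. q j t $ i) analytic_on {t0} \<and>
        (\<forall>\<^sub>F t in nhds t0.
           deriv (deriv (\<lambda>s. q j s $ i)) t = variational_rhs F q0 p q j t $ i))"

section \<open>Differential fields and the differential Galois group\<close>

text \<open>
  All differential fields are subfields of the field \<open>complex fls\<close> of formal Laurent series in
  \<open>t - t0\<close>, with derivation \<open>fls_deriv\<close>, whose field of constants is the image of \<open>\<complex>\<close>
  (lemma \<open>fls_deriv_eq_0_iff_const\<close>). A meromorphic germ at \<open>t0\<close> is identified with its Laurent
  expansion. Since \<open>t0\<close> is a regular point of the variational equations, every solution germ is
  holomorphic at \<open>t0\<close>, and all solutions of the Cauchy problem at \<open>t0\<close> are present in this field.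
\<close>

definition is_subfield :: "'a::field set \<Rightarrow> bool" where
  "is_subfield S \<longleftrightarrow> 0 \<in> S \<and> 1 \<in> S \<and>
     (\<forall>x\<in>S. \<forall>y\<in>S. x - y \<in> S \<and> x * y \<in> S) \<and> (\<forall>x\<in>S. inverse x \<in> S)"

definition is_diff_subfield :: "('a::field \<Rightarrow> 'a) \<Rightarrow> 'a set \<Rightarrow> bool" where
  "is_diff_subfield D S \<longleftrightarrow> is_subfield S \<and> (\<forall>x\<in>S. D x \<in> S)"

lemma fls_deriv_eq_0_iff_const:
  "fls_deriv (f :: complex fls) = 0 \<longleftrightarrow> f \<in> range fls_const"
proof
  assume *: "fls_deriv f = 0"
  have "f = fls_const (fls_nth f 0)"
  proof (rule fls_eqI)
    fix n :: int
    have "of_int n * fls_nth f n = (0 :: complex)"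
      using arg_cong[OF *, of "\<lambda>g. fls_nth g (n - 1)"] by simp
    thus "fls_nth f n = fls_nth (fls_const (fls_nth f 0)) n"
      by (cases "n = 0") auto
  qed
  thus "f \<in> range fls_const" by blast
qed auto

definition germ :: "complex \<Rightarrow> (complex \<Rightarrow> complex) \<Rightarrow> complex fls" where
  "germ t0 f = fps_to_fls (fps_expansion f t0)"

definition ground_field :: "complex \<Rightarrow> (complex \<Rightarrow> complex) \<Rightarrow> complex fls set" where
  "ground_field t0 \<phi> =
     is_subfield hull (range fls_const \<union> {germ t0 \<phi>, germ t0 (deriv \<phi>)})"

definition PV_field ::
    "(complex ^ 'n \<Rightarrow> complex ^ 'n) \<Rightarrow> complex ^ 'n \<Rightarrow> (complex \<Rightarrow> complex) \<Rightarrow> nat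
      \<Rightarrow> complex \<Rightarrow> complex fls set" where
  "PV_field F d \<phi> p t0 =
     is_diff_subfield fls_deriv hull
       (ground_field t0 \<phi> \<union>
        {germ t0 (\<lambda>t. q j t $ i) | q j i. VE_solution F (\<lambda>t. \<phi> t *s d) p t0 q \<and> j \<in> {1..p}})"

definition diff_galois_group ::
    "('a::field \<Rightarrow> 'a) \<Rightarrow> 'a set \<Rightarrow> 'a set \<Rightarrow> ('a \<Rightarrow> 'a) monoid" where
  "diff_galois_group D K L = (BijGroup L)
     \<lparr>carrier := {\<sigma> \<in> Bij L.
        (\<forall>x\<in>L. \<forall>y\<in>L. \<sigma> (x + y) = \<sigma> x + \<sigma> y \<and> \<sigma> (x * y) = \<sigma> x * \<sigma> y) \<and>
        (\<forall>x\<in>L. \<sigma> (D x) = D (\<sigma> x)) \<and>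
        (\<forall>x\<in>K. \<sigma> x = x)}\<rparr>"

end

theory Submission
  imports Defs "HOL-Computational_Algebra.Fundamental_Theorem_Algebra"
begin

text \<open>
  Write \<open>q = \<phi> w\<close> and pass to the time \<open>\<tau>\<close> with \<open>d\<tau> = dt / \<phi>\<^sup>2\<close>. Since the force is homogeneous of
  degree \<open>-3\<close> and \<open>\<phi>'' = - \<gamma> / \<phi>\<^sup>3\<close>, all powers of \<open>\<phi>\<close> cancel and Newton's equation becomes the
  autonomous equation \<open>w'' = F w + \<gamma> w\<close> in \<open>\<tau>\<close>, for which the Darboux point \<open>d\<close> is an equilibrium.
  The higher variational equations at an equilibrium have constant coefficients: the unknown of
  order \<open>j\<close> satisfies a constant linear system whose inhomogeneity is a polynomial with constant
  coefficients in the unknowns of lower order. Hence every component of a solution lies, after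
  division by \<open>\<phi>\<close>, in a finite-dimensional complex vector space that is stable under the derivation
  \<open>\<partial> = \<phi>\<^sup>2 d/dt\<close> (lemma \<open>VE_solution_deriv_finite\<close>). In other
  words, the rescaled solutions are exponential polynomials in \<open>\<tau>\<close>.

  A differential automorphism over the ground field fixes \<open>\<phi>\<^sup>2\<close> and so commutes with \<open>\<partial>\<close>. The constants
  of \<open>\<partial>\<close> are the complex numbers, therefore each eigenspace of \<open>\<partial>\<close> has dimension at most one, and on a
  finite-dimensional stable space \<open>\<partial>\<close> is nonderogatory. A linear map that commutes with a
  nonderogatory one is a polynomial in it (lemma \<open>diffop_kernel_cyclic\<close>), and polynomials in \<open>\<partial>\<close> commute
  with each other. So any two automorphisms commute on the rescaled solutions
  (lemma \<open>galois_commute_on_deriv_finite\<close>). The elements on which two automorphisms commute form a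
  differential subfield, which contains the ground field and now also the generators of the
  Picard-Vessiot field, and so is all of it.

  The analytic part of the argument is the structure of the right-hand sides of the variational
  equations. It rests on the fact that the partial derivatives of a holomorphic function of several
  variables are again holomorphic (lemma \<open>holomorphic_several_grad\<close>), which makes it possible to
  iterate the chain rule (lemma \<open>higher_deriv_along_curve\<close>).
\<close>

\<comment> \<open>Power series coefficients share the dollar sign with vector components, which makes terms ambiguous.\<close>
no_notation fps_nth (infixl "$" 75)

section \<open>Holomorphic functions of several variables\<close>

lemma norm_axis_complex: "norm (axis i c :: complex ^ 'n) = norm c"
proof -
  have "(\<Sum>j\<in>UNIV. (norm (axis i c $ j :: complex))\<^sup>2) = (\<Sum>j\<in>UNIV. if j = i then (norm c)\<^sup>2 else 0)"
    by (intro sum.cong) (auto simp: axis_def)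
  thus ?thesis by (simp add: norm_vec_def L2_set_def)
qed

lemma bounded_linear_axis_complex: "bounded_linear (axis i :: complex \<Rightarrow> complex ^ 'n)"
  by (rule bounded_linear_intro[where K = 1])
     (simp_all add: norm_axis_complex, auto simp: vec_eq_iff axis_def)

text \<open>
  Complex linearity turns the real Frechet derivative into its expression by complex partial
  derivatives, here the components of \<open>grad f q\<close>.
\<close>

lemma holomorphic_several_has_derivative:
  fixes f :: "complex ^ 'n \<Rightarrow> complex"
  assumes "holomorphic_several f U" "q \<in> U"
  shows "(f has_derivative (\<lambda>v. \<Sum>i\<in>UNIV. v $ i * grad f q $ i)) (at q)"
proof -
  obtain L where L: "(f has_derivative L) (at q)" "\<And>c v. L (c *s v) = c * L v"
    using assms unfolding holomorphic_several_def by blast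
  have lin: "linear L"
    using L(1) has_derivative_linear by blast
  have "L v = (\<Sum>i\<in>UNIV. v $ i * grad f q $ i)" for v
  proof -
    have "L v = L (\<Sum>i\<in>UNIV. (v $ i) *s axis i 1)"
      by (simp only: basis_expansion)
    also have "\<dots> = (\<Sum>i\<in>UNIV. v $ i * L (axis i 1))"
      by (simp add: linear_sum[OF lin] L(2))
    finally show ?thesis
      by (simp add: grad_def frechet_derivative_at[OF L(1), symmetric])
  qed
  hence "L = (\<lambda>v. \<Sum>i\<in>UNIV. v $ i * grad f q $ i)" by (rule ext)
  thus ?thesis using L(1) by simp
qed

lemma holomorphic_severalI:
  assumes "\<And>q. q \<in> U \<Longrightarrow> (f has_derivative (\<lambda>v. \<Sum>i\<in>UNIV. v $ i * g q i)) (at q)"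
  shows "holomorphic_several f U"
  unfolding holomorphic_several_def
  by (intro ballI exI conjI, erule assms) (simp add: sum_distrib_left mult.assoc)

lemma holomorphic_several_imp_continuous_on:
  assumes "holomorphic_several f U"
  shows "continuous_on U f"
  using holomorphic_several_has_derivative[OF assms] has_derivative_continuous
  by (blast intro: continuous_at_imp_continuous_on)

lemma axis_sum_mult: "(\<Sum>i\<in>UNIV. (axis j c :: complex ^ 'n) $ i * g i) = c * g j"
  by (simp add: axis_def if_distrib[of "\<lambda>x. x * _"] cong: if_cong)

lemma has_field_derivative_along_axis:
  fixes f :: "complex ^ 'n \<Rightarrow> complex"
  assumes "holomorphic_several f U" "q + axis i \<zeta> \<in> U"
  shows "((\<lambda>\<zeta>. f (q + axis i \<zeta>)) has_field_derivative grad f (q + axis i \<zeta>) $ i) (at \<zeta>)"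
proof -
  have "(axis i has_derivative (axis i :: complex \<Rightarrow> complex ^ 'n)) (at \<zeta>)"
    by (intro bounded_linear_imp_has_derivative bounded_linear_axis_complex)
  hence "((\<lambda>\<zeta>. q + axis i \<zeta>) has_derivative axis i) (at \<zeta>)"
    by (auto intro!: derivative_eq_intros)
  from has_derivative_compose[OF this holomorphic_several_has_derivative[OF assms]]
  show ?thesis
    by (simp add: axis_sum_mult has_field_derivative_def mult.commute[of _ "grad f (q + axis i \<zeta>) $ i"])
qed

text \<open>
  The point \<open>circlepath 0 r x\<close>, as an explicit formula whose norm and continuity are
  immediate.
\<close>

definition turn :: "real \<Rightarrow> real \<Rightarrow> complex"
  where "turn r x = of_real r * exp (2 * of_real pi * \<i> * of_real x)"

lemma norm_turn: "r \<ge> 0 \<Longrightarrow> norm (turn r x) = r"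
  by (simp add: turn_def norm_mult)

text \<open>
  Cauchy's formula for the first derivative in the \<open>i\<close>-th coordinate. The factor \<open>1 / \<zeta>\<^sup>2\<close> of the kernel and
  the velocity \<open>2 \<pi> \<i> \<zeta>\<close> of the circle combine to \<open>1 / \<zeta>\<close>. The integral contains only values of \<open>f\<close>, which
  is what allows regularity to pass from \<open>f\<close> to its partial derivatives.
\<close>

lemma grad_eq_integral:
  fixes f :: "complex ^ 'n \<Rightarrow> complex"
  assumes f: "holomorphic_several f U" and r: "r > 0" and U: "cball q r \<subseteq> U"
  shows "((\<lambda>x. f (q + axis i (turn r x)) / turn r x) has_integral grad f q $ i) {0..1}"
proof -
  define g where "g = (\<lambda>\<zeta>. f (q + axis i \<zeta>))"
  have der: "(g has_field_derivative grad f (q + axis i \<zeta>) $ i) (at \<zeta>)" if "\<zeta> \<in> cball 0 r" for \<zeta>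
    unfolding g_def using that U
    by (intro has_field_derivative_along_axis[OF f]) (auto simp: dist_norm norm_axis_complex subset_iff)
  have cont: "continuous_on (cball 0 r) g"
    by (intro continuous_at_imp_continuous_on ballI) (meson der DERIV_isCont)
  have hol: "g holomorphic_on ball 0 r"
    unfolding holomorphic_on_def field_differentiable_def
    by (intro ballI exI, rule has_field_derivative_at_within, rule der) simp
  have "((\<lambda>u. g u / (u - 0) ^ Suc 1) has_contour_integral ((2 * pi * \<i>) / (fact 1) * (deriv ^^ 1) g 0))
           (circlepath 0 r)"
    by (rule Cauchy_has_contour_integral_higher_derivative_circlepath[OF cont hol]) (use r in simp)
  moreover have "deriv g 0 = grad f q $ i"
    using DERIV_imp_deriv[OF der[of 0]] r by (simp add: axis_def vec_eq_iff zero_vec_def[symmetric])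
  ultimately have "((\<lambda>x. g (circlepath 0 r x) / (circlepath 0 r x)\<^sup>2 *
      vector_derivative (circlepath 0 r) (at x within {0..1})) has_integral
      2 * pi * \<i> * grad f q $ i) {0..1}"
    by (simp add: has_contour_integral_def power2_eq_square)
  hence "((\<lambda>x. g (turn r x) / (turn r x)\<^sup>2 * (2 * pi * \<i> * turn r x)) has_integral
      2 * pi * \<i> * grad f q $ i) {0..1}"
    by (rule has_integral_eq[rotated])
       (simp add: vector_derivative_circlepath01, simp add: circlepath turn_def)
  from has_integral_divide[OF this, of "2 * pi * \<i>"] show ?thesis
    using r by (rule_tac has_integral_eq[rotated])
       (auto simp: g_def turn_def power2_eq_square field_simps)
qed

text \<open>
  The integral formula is used twice. It first shows that the partial derivatives are continuous,
  because \<open>f\<close> is; so \<open>f\<close> is continuously differentiable. This is the hypothesis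
  for differentiation under the integral sign in the same formula, and the resulting derivative is
  complex linear because the integrand is.
\<close>

lemma holomorphic_several_grad:
  fixes f :: "complex ^ 'n \<Rightarrow> complex"
  assumes f: "holomorphic_several f U" and U: "open U"
  shows "holomorphic_several (\<lambda>q. grad f q $ i) U"
proof -
  have turn_cont [continuous_intros]: "continuous_on A (\<lambda>x. turn r (g x))"
    if "continuous_on A g" for A r and g :: "'z::t2_space \<Rightarrow> real"
    unfolding turn_def by (intro continuous_intros that)
  have axis_cont [continuous_intros]: "continuous_on A (\<lambda>x. axis k (g x) :: complex ^ 'n)"
    if "continuous_on A g" for A k and g :: "'z::t2_space \<Rightarrow> complex"
    by (rule bounded_linear.continuous_on[OF bounded_linear_axis_complex that])
  \<comment> \<open>The radius \<open>2 r\<close> leaves room for circles of radius \<open>r\<close> around all points of \<open>ball q r\<close>.\<close>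
  have loc: "\<exists>r>0. ball q (2*r) \<subseteq> U" if "q \<in> U" for q
  proof -
    from that U obtain e where "e > 0" "ball q e \<subseteq> U"
      unfolding open_contains_ball by blast
    thus ?thesis by (intro exI[of _ "e / 2"]) simp
  qed
  have inU: "q' + axis k (turn r x) \<in> U" if "r > 0" "ball q (2*r) \<subseteq> U" "q' \<in> ball q r" for q q' r x k
  proof -
    have "dist q (q' + axis k (turn r x)) \<le> dist q q' + dist q' (q' + axis k (turn r x))"
      by (rule dist_triangle)
    also have "dist q' (q' + axis k (turn r x)) = r"
      using that(1) by (simp add: dist_norm norm_axis_complex norm_turn)
    also have "dist q q' + r < 2 * r"
      using that(3) by simp
    finally show ?thesis
      using that(2) by (meson mem_ball subsetD)
  qed
  have grad_int: "((\<lambda>x. f (q' + axis k (turn r x)) / turn r x) has_integral grad f q' $ k) {0..1}"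
    if "r > 0" "ball q (2*r) \<subseteq> U" "q' \<in> ball q r" for q q' r k
  proof (rule grad_eq_integral[OF f])
    show "cball q' r \<subseteq> U"
    proof
      fix y assume "y \<in> cball q' r"
      hence "dist q y < 2 * r" using that dist_triangle[of q y q'] by (auto simp: dist_commute)
      thus "y \<in> U" using that by auto
    qed
  qed (use that in auto)
  have cont_grad: "continuous_on U (\<lambda>q. grad f q $ k)" for k
  proof (rule continuous_at_imp_continuous_on, rule ballI)
    fix q assume "q \<in> U"
    then obtain r where r: "r > 0" "ball q (2*r) \<subseteq> U" using loc by blast
    have "continuous_on (ball q r) (\<lambda>q'. integral (cbox 0 1) (\<lambda>x. f (q' + axis k (turn r x)) / turn r x))"
    proof (rule integral_continuous_on_param, unfold case_prod_unfold)
      have "continuous_on (ball q r \<times> cbox 0 1) (\<lambda>z. f (fst z + axis k (turn r (snd z))))"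
        by (rule continuous_on_compose2[OF holomorphic_several_imp_continuous_on[OF f]])
           (auto intro!: continuous_intros inU[OF r])
      thus "continuous_on (ball q r \<times> cbox 0 1) (\<lambda>z. f (fst z + axis k (turn r (snd z))) / turn r (snd z))"
        using r by (intro continuous_intros) (auto simp: turn_def)
    qed
    also have "?this \<longleftrightarrow> continuous_on (ball q r) (\<lambda>q. grad f q $ k)"
      by (intro continuous_on_cong refl) (use integral_unique[OF grad_int[OF r]] in auto)
    finally show "isCont (\<lambda>q. grad f q $ k) q"
      using r by (simp add: continuous_on_eq_continuous_at)
  qed
  define DF where "DF = (\<lambda>q. Blinfun (\<lambda>v. \<Sum>k\<in>UNIV. v $ k * grad f q $ k))"
  have DF: "blinfun_apply (DF q) = (\<lambda>v. \<Sum>k\<in>UNIV. v $ k * grad f q $ k)" for q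
    unfolding DF_def
    by (intro bounded_linear_Blinfun_apply bounded_linear_sum bounded_linear_mult_const
          bounded_linear_vec_nth)
  have cont_DF: "continuous_on U DF"
    by (rule continuous_on_blinfun_componentwise) (auto simp: DF intro!: continuous_intros cont_grad)
  show ?thesis
    unfolding holomorphic_several_def
  proof (intro ballI)
    fix q assume "q \<in> U"
    then obtain r where r: "r > 0" "ball q (2*r) \<subseteq> U" using loc by blast
    define B where "B = ball q r"
    have qB: "q \<in> B" using r by (simp add: B_def)
    note inU = inU[OF r, folded B_def] and grad_int = grad_int[OF r, folded B_def]
    define G where "G = (\<lambda>q' x. f (q' + axis i (turn r x)) / turn r x)"
    define G' where "G' = (\<lambda>q' x.
       Blinfun (\<lambda>v. (\<Sum>k\<in>UNIV. v $ k * grad f (q' + axis i (turn r x)) $ k) / turn r x))"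
    have G': "blinfun_apply (G' q' x) =
        (\<lambda>v. (\<Sum>k\<in>UNIV. v $ k * grad f (q' + axis i (turn r x)) $ k) / turn r x)" for q' x
      unfolding G'_def divide_inverse
      by (intro bounded_linear_Blinfun_apply bounded_linear_sum bounded_linear_mult_const
            bounded_linear_vec_nth)
    have turn_ne: "turn r x \<noteq> 0" for x
      using r by (simp add: turn_def)
    have cont: "continuous_on (B \<times> cbox 0 1) (\<lambda>(q', x). G' q' x)"
    proof (rule continuous_on_blinfun_componentwise, unfold case_prod_unfold G')
      fix v :: "complex ^ 'n"
      have "continuous_on (B \<times> cbox 0 1) (\<lambda>z. grad f (fst z + axis i (turn r (snd z))) $ k)" for k
        by (rule continuous_on_compose2[OF cont_grad])
           (auto intro!: continuous_intros inU)
      thus "continuous_on (B \<times> cbox 0 1) (\<lambda>z. (\<Sum>k\<in>UNIV. v $ k *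
              grad f (fst z + axis i (turn r (snd z))) $ k) / turn r (snd z))"
        using turn_ne by (intro continuous_on_divide continuous_on_sum continuous_on_mult turn_cont
            continuous_on_const continuous_on_snd continuous_on_id) auto
    qed
    have "((\<lambda>q'. integral (cbox 0 1) (G q')) has_derivative integral (cbox 0 1) (G' q)) (at q within B)"
    proof (rule leibniz_rule[OF _ _ cont qB])
      fix q' x assume q': "q' \<in> B" 
      have "((\<lambda>q'. f (q' + axis i (turn r x))) has_derivative
          (\<lambda>v. \<Sum>k\<in>UNIV. v $ k * grad f (q' + axis i (turn r x)) $ k)) (at q')"
        by (rule has_derivative_compose[where f = "\<lambda>q'. q' + axis i (turn r x)" and g = f,
            OF _ holomorphic_several_has_derivative[OF f inU[OF q', of i x]]])
           (auto intro!: derivative_eq_intros)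
      hence "((\<lambda>q'. G q' x) has_derivative G' q' x) (at q')"
        unfolding G_def G' divide_inverse by (intro has_derivative_mult_left)
      thus "((\<lambda>q'. G q' x) has_derivative G' q' x) (at q' within B)"
        by (rule has_derivative_at_withinI)
    next
      fix q' assume "q' \<in> B"
      thus "G q' integrable_on cbox 0 1"
        using grad_int[of q' i] unfolding G_def by (auto simp: integrable_on_def)
    qed (simp add: B_def)
    hence "((\<lambda>q. grad f q $ i) has_derivative integral (cbox 0 1) (G' q)) (at q within B)"
      by (rule has_derivative_transform[OF qB, rotated])
         (use integral_unique[OF grad_int] in \<open>auto simp: G_def\<close>)
    hence der: "((\<lambda>q. grad f q $ i) has_derivative integral (cbox 0 1) (G' q)) (at q)"
      using at_within_open[OF qB] by (simp add: B_def)
    have int: "(G' q) integrable_on cbox 0 1"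
    proof (rule integrable_continuous)
      have "continuous_on (cbox 0 1) (\<lambda>x. (\<lambda>(q', x). G' q' x) (q, x))"
        by (rule continuous_on_compose2[OF cont])
           (use qB in \<open>auto intro!: continuous_intros\<close>)
      thus "continuous_on (cbox 0 1) (G' q)" by simp
    qed
    have "integral (cbox 0 1) (G' q) (c *s v) = c * integral (cbox 0 1) (G' q) v" for c v
      unfolding blinfun_apply_integral[OF int]
      by (subst integral_mult_right[symmetric])
         (simp add: G' sum_distrib_left mult.assoc sum_divide_distrib)
    with der show "\<exists>L. ((\<lambda>q. grad f q $ i) has_derivative L) (at q) \<and> (\<forall>c v. L (c *s v) = c * L v)"
      by blast
  qed
qed

section \<open>The chain rule for higher derivatives along a curve\<close>

definition holomorphic_curve :: "complex set \<Rightarrow> (complex \<Rightarrow> complex ^ 'n) \<Rightarrow> (complex ^ 'n) set \<Rightarrow> bool"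
  where "holomorphic_curve S c U \<longleftrightarrow>
    open S \<and> c ` S \<subseteq> U \<and> (\<forall>i. (\<lambda>s. c s $ i) holomorphic_on S)"

lemma has_field_derivative_along_curve:
  fixes f :: "complex ^ 'n \<Rightarrow> complex"
  assumes f: "holomorphic_several f U" and c: "holomorphic_curve S c U" and \<epsilon>: "\<epsilon> \<in> S"
  shows "((\<lambda>s. f (c s)) has_field_derivative
           (\<Sum>i\<in>UNIV. grad f (c \<epsilon>) $ i * deriv (\<lambda>s. c s $ i) \<epsilon>)) (at \<epsilon>)"
proof -
  have "((\<lambda>s. c s $ i) has_derivative (\<lambda>h. deriv (\<lambda>s. c s $ i) \<epsilon> * h)) (at \<epsilon>)" for i
    using c \<epsilon> holomorphic_derivI[of "\<lambda>s. c s $ i" S \<epsilon>]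
    by (auto simp: holomorphic_curve_def has_field_derivative_def)
  hence "((\<lambda>s. \<Sum>i\<in>UNIV. axis i (c s $ i)) has_derivative
      (\<lambda>h. \<Sum>i\<in>UNIV. axis i (deriv (\<lambda>s. c s $ i) \<epsilon> * h))) (at \<epsilon>)"
    by (intro has_derivative_sum bounded_linear.has_derivative[OF bounded_linear_axis_complex])
  moreover have axis_sum: "(\<Sum>i\<in>UNIV. axis i (a i)) $ k = a k" for a :: "'n \<Rightarrow> complex" and k
    by (simp add: axis_def)
  hence "(\<Sum>i\<in>UNIV. axis i (c s $ i)) = c s" for s
    by (simp add: vec_eq_iff del: sum_component)
  moreover have "c \<epsilon> \<in> U" using c \<epsilon> by (auto simp: holomorphic_curve_def)
  ultimately have "((\<lambda>s. f (c s)) has_derivative (\<lambda>h. \<Sum>k\<in>UNIV.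
      (\<Sum>i\<in>UNIV. axis i (deriv (\<lambda>s. c s $ i) \<epsilon> * h)) $ k * grad f (c \<epsilon>) $ k)) (at \<epsilon>)"
    by (intro has_derivative_compose[OF _ holomorphic_several_has_derivative[OF f]]) simp_all
  moreover have "(\<lambda>h. \<Sum>k\<in>UNIV. deriv (\<lambda>s. c s $ k) \<epsilon> * h * grad f (c \<epsilon>) $ k) =
      (*) (\<Sum>i\<in>UNIV. grad f (c \<epsilon>) $ i * deriv (\<lambda>s. c s $ i) \<epsilon>)"
    by (auto simp: fun_eq_iff sum_distrib_left sum_distrib_right mult_ac)
  ultimately show ?thesis
    by (simp only: axis_sum has_field_derivative_def)
qed

text \<open>
  Functionals of a curve \<open>c\<close>: polynomials in the derivatives of \<open>c\<close> of positive order less than \<open>j\<close>,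
  whose coefficients are holomorphic functions of the position \<open>c \<epsilon>\<close>. One functional has to serve for all
  curves: in the application the curve depends on time, whereas the coefficients, evaluated at
  \<open>c 0 = d\<close>, must not.
\<close>

inductive_set jet_polynomials ::
    "(complex ^ 'n) set \<Rightarrow> nat \<Rightarrow> ((complex \<Rightarrow> complex ^ 'n) \<Rightarrow> complex \<Rightarrow> complex) set"
  for U j where
    coefficient: "holomorphic_several f U \<Longrightarrow> (\<lambda>c \<epsilon>. f (c \<epsilon>)) \<in> jet_polynomials U j"
  | jet: "1 \<le> m \<Longrightarrow> m < j \<Longrightarrow> (\<lambda>c \<epsilon>. (deriv ^^ m) (\<lambda>s. c s $ i) \<epsilon>) \<in> jet_polynomials U j"
  | add: "G \<in> jet_polynomials U j \<Longrightarrow> H \<in> jet_polynomials U j \<Longrightarrow>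
      (\<lambda>c \<epsilon>. G c \<epsilon> + H c \<epsilon>) \<in> jet_polynomials U j"
  | mult: "G \<in> jet_polynomials U j \<Longrightarrow> H \<in> jet_polynomials U j \<Longrightarrow>
      (\<lambda>c \<epsilon>. G c \<epsilon> * H c \<epsilon>) \<in> jet_polynomials U j"

lemma holomorphic_several_const: "holomorphic_several (\<lambda>_. a) U"
  by (rule holomorphic_severalI[where g = "\<lambda>_ _. 0"]) simp

lemma jet_polynomials_sum:
  assumes "finite I" "\<And>i. i \<in> I \<Longrightarrow> G i \<in> jet_polynomials U j"
  shows "(\<lambda>c \<epsilon>. \<Sum>i\<in>I. G i c \<epsilon>) \<in> jet_polynomials U j"
  using assms
proof (induction I rule: finite_induct)
  case empty
  show ?case using jet_polynomials.coefficient[OF holomorphic_several_const[of 0]] by simp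
next
  case (insert i I)
  thus ?case using jet_polynomials.add[of "G i" U j "\<lambda>c \<epsilon>. \<Sum>i\<in>I. G i c \<epsilon>"] by simp
qed

lemma jet_polynomials_mono:
  assumes "G \<in> jet_polynomials U j"
  shows "G \<in> jet_polynomials U (Suc j)"
  using assms by induction (auto intro: jet_polynomials.intros)

text \<open>
  Differentiating a coefficient brings in first derivatives of the curve; they are
  of order less than \<open>Suc j\<close> because \<open>j \<ge> 1\<close>.
\<close>

lemma jet_polynomials_deriv:
  assumes "G \<in> jet_polynomials U j" "j \<ge> 1" "open U"
  shows "\<exists>G'\<in>jet_polynomials U (Suc j). \<forall>S c. holomorphic_curve S c U \<longrightarrow>
           (\<forall>\<epsilon>\<in>S. (G c has_field_derivative G' c \<epsilon>) (at \<epsilon>))"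
  using assms(1)
proof induction
  case (coefficient f)
  have "(\<lambda>c \<epsilon>. \<Sum>i\<in>UNIV. grad f (c \<epsilon>) $ i * (deriv ^^ 1) (\<lambda>s. c s $ i) \<epsilon>) \<in> jet_polynomials U (Suc j)"
    using coefficient assms(2,3)
    by (intro jet_polynomials_sum jet_polynomials.mult jet_polynomials.jet
          jet_polynomials.coefficient[of "\<lambda>q. grad f q $ _"] holomorphic_several_grad) auto
  thus ?case
    by (rule rev_bexI) (use has_field_derivative_along_curve[OF coefficient] in auto)
next
  case (jet m i)
  have "(\<lambda>c \<epsilon>. (deriv ^^ Suc m) (\<lambda>s. c s $ i) \<epsilon>) \<in> jet_polynomials U (Suc j)"
    using jet by (intro jet_polynomials.jet) auto
  moreover have "((deriv ^^ m) (\<lambda>s. c s $ i) has_field_derivative (deriv ^^ Suc m) (\<lambda>s. c s $ i) \<epsilon>) (at \<epsilon>)"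
    if "holomorphic_curve S c U" "\<epsilon> \<in> S" for S c \<epsilon>
    using that holomorphic_derivI[OF holomorphic_higher_deriv[of "\<lambda>s. c s $ i" S m], of \<epsilon>]
    by (auto simp: holomorphic_curve_def)
  ultimately show ?case by (intro bexI[where x = "\<lambda>c \<epsilon>. (deriv ^^ Suc m) (\<lambda>s. c s $ i) \<epsilon>"]) blast+
next
  case (add G H)
  from add.IH(1) obtain G' where G': "G' \<in> jet_polynomials U (Suc j)" and
    der_G: "\<And>S c \<epsilon>. holomorphic_curve S c U \<Longrightarrow> \<epsilon> \<in> S \<Longrightarrow> (G c has_field_derivative G' c \<epsilon>) (at \<epsilon>)"
    by blast
  from add.IH(2) obtain H' where H': "H' \<in> jet_polynomials U (Suc j)" and
    der_H: "\<And>S c \<epsilon>. holomorphic_curve S c U \<Longrightarrow> \<epsilon> \<in> S \<Longrightarrow> (H c has_field_derivative H' c \<epsilon>) (at \<epsilon>)"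
    by blast
  show ?case
    by (rule rev_bexI[OF jet_polynomials.add[OF G' H']]) (intro allI impI ballI DERIV_add der_G der_H)
next
  case (mult G H)
  from mult.IH(1) obtain G' where G': "G' \<in> jet_polynomials U (Suc j)" and
    der_G: "\<And>S c \<epsilon>. holomorphic_curve S c U \<Longrightarrow> \<epsilon> \<in> S \<Longrightarrow> (G c has_field_derivative G' c \<epsilon>) (at \<epsilon>)"
    by blast
  from mult.IH(2) obtain H' where H': "H' \<in> jet_polynomials U (Suc j)" and
    der_H: "\<And>S c \<epsilon>. holomorphic_curve S c U \<Longrightarrow> \<epsilon> \<in> S \<Longrightarrow> (H c has_field_derivative H' c \<epsilon>) (at \<epsilon>)"
    by blast
  note mem = jet_polynomials.add[OF jet_polynomials.mult[OF G' jet_polynomials_mono[OF mult.hyps(2)]]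
      jet_polynomials.mult[OF H' jet_polynomials_mono[OF mult.hyps(1)]]]
  show ?case
    by (rule rev_bexI[OF mem]) (intro allI impI ballI DERIV_mult der_G der_H)
qed

text \<open>
  The derivative of highest order enters linearly, through the gradient of \<open>f\<close> alone. This is why the
  variational equation of each order has the same homogeneous part as the first one.
\<close>

lemma higher_deriv_along_curve:
  fixes f :: "complex ^ 'n \<Rightarrow> complex"
  assumes f: "holomorphic_several f U" and U: "open U" and j: "j \<ge> 1"
  shows "\<exists>G\<in>jet_polynomials U j. \<forall>S c. holomorphic_curve S c U \<longrightarrow> (\<forall>\<epsilon>\<in>S.
           (deriv ^^ j) (\<lambda>s. f (c s)) \<epsilon> =
           (\<Sum>i\<in>UNIV. grad f (c \<epsilon>) $ i * (deriv ^^ j) (\<lambda>s. c s $ i) \<epsilon>) + G c \<epsilon>)"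
  using j
proof (induction j rule: dec_induct)
  case base
  show ?case
    by (rule rev_bexI[OF jet_polynomials.coefficient[OF holomorphic_several_const[of 0]]])
       (use DERIV_imp_deriv[OF has_field_derivative_along_curve[OF f]] in auto)
next
  case (step j)
  then obtain G where G: "G \<in> jet_polynomials U j" and
    eq: "\<And>S c \<epsilon>. holomorphic_curve S c U \<Longrightarrow> \<epsilon> \<in> S \<Longrightarrow>
           (deriv ^^ j) (\<lambda>s. f (c s)) \<epsilon> =
           (\<Sum>i\<in>UNIV. grad f (c \<epsilon>) $ i * (deriv ^^ j) (\<lambda>s. c s $ i) \<epsilon>) + G c \<epsilon>"
    by blast
  obtain G' where G': "G' \<in> jet_polynomials U (Suc j)" and
    der_G: "\<And>S c \<epsilon>. holomorphic_curve S c U \<Longrightarrow> \<epsilon> \<in> S \<Longrightarrow> (G c has_field_derivative G' c \<epsilon>) (at \<epsilon>)"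
    using jet_polynomials_deriv[OF G _ U] step.hyps by blast
  \<comment> \<open>The terms of the product rule that do not contain a derivative of order \<open>Suc j\<close>.\<close>
  define H where "H = (\<lambda>c \<epsilon>. (\<Sum>i\<in>UNIV.
      (\<Sum>k\<in>UNIV. grad (\<lambda>q. grad f q $ i) (c \<epsilon>) $ k * (deriv ^^ 1) (\<lambda>s. c s $ k) \<epsilon>) *
      (deriv ^^ j) (\<lambda>s. c s $ i) \<epsilon>) + G' c \<epsilon>)"
  have "H \<in> jet_polynomials U (Suc j)"
    unfolding H_def using step.hyps
    by (intro jet_polynomials.add G' jet_polynomials_sum jet_polynomials.mult jet_polynomials.jet
          jet_polynomials.coefficient[of "\<lambda>q. grad (\<lambda>q. grad f q $ _) q $ _"]
          holomorphic_several_grad f U) auto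
  moreover have "(deriv ^^ Suc j) (\<lambda>s. f (c s)) \<epsilon> =
      (\<Sum>i\<in>UNIV. grad f (c \<epsilon>) $ i * (deriv ^^ Suc j) (\<lambda>s. c s $ i) \<epsilon>) + H c \<epsilon>"
    if c: "holomorphic_curve S c U" and \<epsilon>: "\<epsilon> \<in> S" for S c \<epsilon>
  proof -
    have "open S" using c by (simp add: holomorphic_curve_def)
    hence "\<forall>\<^sub>F \<epsilon> in nhds \<epsilon>. (deriv ^^ j) (\<lambda>s. f (c s)) \<epsilon> =
           (\<Sum>i\<in>UNIV. grad f (c \<epsilon>) $ i * (deriv ^^ j) (\<lambda>s. c s $ i) \<epsilon>) + G c \<epsilon>"
      using \<epsilon> eq[OF c] by (auto intro: eventually_nhds_in_open[THEN eventually_mono])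
    hence "(deriv ^^ Suc j) (\<lambda>s. f (c s)) \<epsilon> =
        deriv (\<lambda>\<epsilon>. (\<Sum>i\<in>UNIV. grad f (c \<epsilon>) $ i * (deriv ^^ j) (\<lambda>s. c s $ i) \<epsilon>) + G c \<epsilon>) \<epsilon>"
      by (simp add: deriv_cong_ev)
    also have "\<dots> = (\<Sum>i\<in>UNIV. (\<Sum>k\<in>UNIV. grad (\<lambda>q. grad f q $ i) (c \<epsilon>) $ k * deriv (\<lambda>s. c s $ k) \<epsilon>) *
        (deriv ^^ j) (\<lambda>s. c s $ i) \<epsilon> + (deriv ^^ Suc j) (\<lambda>s. c s $ i) \<epsilon> * grad f (c \<epsilon>) $ i) + G' c \<epsilon>"
    proof (intro DERIV_imp_deriv DERIV_add DERIV_sum DERIV_mult der_G[OF c \<epsilon>]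
        has_field_derivative_along_curve[OF holomorphic_several_grad[OF f U] c \<epsilon>])
      show "((deriv ^^ j) (\<lambda>s. c s $ i) has_field_derivative (deriv ^^ Suc j) (\<lambda>s. c s $ i) \<epsilon>) (at \<epsilon>)" for i
        using c \<epsilon> holomorphic_derivI[OF holomorphic_higher_deriv[of "\<lambda>s. c s $ i" S j], of \<epsilon>]
        by (auto simp: holomorphic_curve_def)
    qed
    finally show ?thesis
      by (simp add: H_def sum.distrib mult.commute[of _ "grad f (c \<epsilon>) $ _"])
  qed
  ultimately show ?case by blast
qed

section \<open>Constant-coefficient operators in a rescaled derivation\<close>

text \<open>
  The derivation with respect to a time \<open>\<tau>\<close> such that \<open>dt = u d\<tau>\<close>.
\<close>

definition rescaled_deriv :: "complex fls \<Rightarrow> complex fls \<Rightarrow> complex fls"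
  where "rescaled_deriv u x = u * fls_deriv x"

lemma rescaled_deriv_simps [simp]:
  "rescaled_deriv u (x + y) = rescaled_deriv u x + rescaled_deriv u y"
  "rescaled_deriv u (x - y) = rescaled_deriv u x - rescaled_deriv u y"
  "rescaled_deriv u 0 = 0"
  "rescaled_deriv u (fls_const c) = 0"
  "rescaled_deriv u (fls_const c * x) = fls_const c * rescaled_deriv u x"
  by (simp_all add: rescaled_deriv_def algebra_simps)

lemma rescaled_deriv_mult:
  "rescaled_deriv u (x * y) = rescaled_deriv u x * y + x * rescaled_deriv u y"
  by (simp add: rescaled_deriv_def algebra_simps)

lemma rescaled_deriv_sum: "rescaled_deriv u (sum f A) = (\<Sum>a\<in>A. rescaled_deriv u (f a))"
  by (induction A rule: infinite_finite_induct) simp_all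

text \<open>
  The quotient of two eigenvectors for the same eigenvalue has derivative zero, and the only Laurent
  series with derivative zero are the constants.
\<close>

lemma rescaled_deriv_eigenvectors_proportional:
  assumes "u \<noteq> 0" and x: "rescaled_deriv u x = fls_const \<mu> * x"
    and y: "rescaled_deriv u y = fls_const \<mu> * y" "y \<noteq> 0"
  shows "\<exists>c. x = fls_const c * y"
proof -
  define z where "z = x / y"
  have xz: "x = z * y" using y by (simp add: z_def)
  have "rescaled_deriv u z * y = 0"
    using x y by (simp add: xz rescaled_deriv_mult algebra_simps)
  hence "fls_deriv z = 0"
    using assms by (simp add: rescaled_deriv_def)
  then obtain c where "z = fls_const c"
    unfolding fls_deriv_eq_0_iff_const by blast
  thus ?thesis using xz by blast
qed

definition diffop :: "complex fls \<Rightarrow> complex poly \<Rightarrow> complex fls \<Rightarrow> complex fls"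
  where "diffop u P x = (\<Sum>i\<le>degree P. fls_const (coeff P i) * (rescaled_deriv u ^^ i) x)"

lemma diffop_bound:
  assumes "degree P \<le> n"
  shows "diffop u P x = (\<Sum>i\<le>n. fls_const (coeff P i) * (rescaled_deriv u ^^ i) x)"
  unfolding diffop_def
  by (rule sum.mono_neutral_left) (use assms in \<open>auto simp: coeff_eq_0\<close>)

lemma diffop_0 [simp]: "diffop u 0 x = 0"
  by (simp add: diffop_def)

lemma funpow_rescaled_deriv_simps:
  "(rescaled_deriv u ^^ i) (x + y) = (rescaled_deriv u ^^ i) x + (rescaled_deriv u ^^ i) y"
  "(rescaled_deriv u ^^ i) (x - y) = (rescaled_deriv u ^^ i) x - (rescaled_deriv u ^^ i) y"
  "(rescaled_deriv u ^^ i) (fls_const c * x) = fls_const c * (rescaled_deriv u ^^ i) x"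
  by (induction i) simp_all

lemma diffop_linear:
  "diffop u P (x + y) = diffop u P x + diffop u P y"
  "diffop u P (x - y) = diffop u P x - diffop u P y"
  "diffop u P (fls_const c * x) = fls_const c * diffop u P x"
  by (simp_all add: diffop_def funpow_rescaled_deriv_simps distrib_left right_diff_distrib
        sum.distrib sum_subtractf sum_distrib_left mult.left_commute)

lemma diffop_zero_right [simp]: "diffop u P 0 = 0"
  using diffop_linear(2)[of u P 0 0] by simp

lemma diffop_pCons: "diffop u (pCons a P) x = fls_const a * x + diffop u P (rescaled_deriv u x)"
proof -
  have "diffop u (pCons a P) x = 
    (\<Sum>i\<le>Suc (degree P). fls_const (coeff (pCons a P) i) * (rescaled_deriv u ^^ i) x)"
    by (rule diffop_bound) (rule degree_pCons_le)
  also have "\<dots> = fls_const a * x + diffop u P (rescaled_deriv u x)"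
    by (subst sum.atMost_Suc_shift) (simp add: diffop_def funpow_Suc_right del: funpow.simps(2))
  finally show ?thesis .
qed

lemma diffop_commute: "diffop u P (rescaled_deriv u x) = rescaled_deriv u (diffop u P x)"
  by (simp add: diffop_def rescaled_deriv_sum funpow_swap1)

lemma diffop_add: "diffop u (P + Q) x = diffop u P x + diffop u Q x"
proof -
  define n where "n = max (degree P) (degree Q)"
  have "degree P \<le> n" "degree Q \<le> n" "degree (P + Q) \<le> n"
    by (auto simp: n_def intro: degree_add_le)
  thus ?thesis
    unfolding diffop_bound[OF \<open>degree P \<le> n\<close>] diffop_bound[OF \<open>degree Q \<le> n\<close>]
      diffop_bound[OF \<open>degree (P + Q) \<le> n\<close>]
    by (simp only: coeff_add fls_plus_const[symmetric] distrib_right sum.distrib)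
qed

lemma diffop_smult: "diffop u (smult c P) x = fls_const c * diffop u P x"
  by (cases "c = 0") (simp_all add: diffop_def sum_distrib_left mult.assoc[symmetric])

lemma diffop_mult: "diffop u (P * Q) x = diffop u P (diffop u Q x)"
  by (induction P arbitrary: x)
     (simp_all add: diffop_add diffop_smult diffop_pCons diffop_commute)

lemma diffop_mult_swap: "diffop u P (diffop u Q x) = diffop u Q (diffop u P x)"
  by (metis diffop_mult mult.commute)

text \<open>
  The kernel of \<open>diffop u P\<close> is generated by \<open>y\<close> under the derivation as soon as \<open>P\<close> is the minimal polynomial
  of \<open>y\<close>. In terms of dimensions: the kernel has dimension at most \<open>degree P\<close>, since eigenspaces are at most
  one-dimensional, and the multiples of \<open>y\<close> already fill that dimension. The induction splits off a
  linear factor of \<open>P\<close>, whose operator is called \<open>S\<close>: it lifts a representation of \<open>S z\<close> to one of \<open>z\<close>, up to an eigenvector, and the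
  eigenvector is a multiple of \<open>diffop u Q y\<close>, which is nonzero by minimality.
\<close>

lemma diffop_kernel_cyclic:
  assumes u: "u \<noteq> 0"
  assumes "diffop u P y = 0" "P \<noteq> 0"
    and "\<And>Q. diffop u Q y = 0 \<Longrightarrow> Q \<noteq> 0 \<Longrightarrow> degree P \<le> degree Q"
    and "diffop u P z = 0"
  shows "\<exists>A. z = diffop u A y"
  using assms(2-)
proof (induction "degree P" arbitrary: P y z)
  case 0
  then obtain a where "P = [:a:]" "a \<noteq> 0"
    by (metis degree_eq_zeroE pCons_eq_0_iff)
  with 0 have "fls_const a * z = 0" by (simp add: diffop_pCons)
  hence "z = diffop u 0 y" using \<open>a \<noteq> 0\<close> by simp
  thus ?case by blast
next
  case (Suc n)
  have "\<not> constant (poly P)" using Suc.hyps(2) by (simp add: constant_degree)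
  then obtain \<mu> where "poly P \<mu> = 0"
    using fundamental_theorem_of_algebra by blast
  then obtain Q where P: "P = [:- \<mu>, 1:] * Q"
    by (auto simp: poly_eq_0_iff_dvd)
  have "Q \<noteq> 0" using Suc.prems P by auto
  hence dP: "degree P = Suc (degree Q)" by (simp add: P degree_mult_eq del: mult_pCons_left)
  define S where "S = (\<lambda>x. diffop u [:- \<mu>, 1:] x)"
  have PQ: "diffop u P x = diffop u Q (S x)" "diffop u P x = S (diffop u Q x)" for x
    unfolding P S_def by (metis diffop_mult mult.commute) (metis diffop_mult)
  have Seq: "S x = rescaled_deriv u x - fls_const \<mu> * x" for x
    by (simp add: S_def diffop_pCons fls_const_uminus)
  have "\<exists>A. S z = diffop u A (S y)"
  proof (rule Suc.hyps(1))
    show "n = degree Q" using Suc.hyps(2) dP by simp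
    show "diffop u Q (S y) = 0" "diffop u Q (S z) = 0"
      using Suc.prems PQ by simp_all
    show "degree Q \<le> degree R" if "diffop u R (S y) = 0" "R \<noteq> 0" for R
    proof -
      have "diffop u (R * [:- \<mu>, 1:]) y = 0"
        using that by (simp add: S_def diffop_mult del: mult_pCons_right)
      moreover have "R * [:- \<mu>, 1:] \<noteq> 0" using that by (simp del: mult_pCons_right)
      ultimately have "degree P \<le> degree (R * [:- \<mu>, 1:])" using Suc.prems(3) by blast
      thus ?thesis using that dP by (simp add: degree_mult_eq del: mult_pCons_right)
    qed
  qed fact+
  then obtain A where A: "S z = diffop u A (S y)" by blast
  define e where "e = diffop u Q y"
  have "e \<noteq> 0" using Suc.prems(3)[of Q] \<open>Q \<noteq> 0\<close> dP by (auto simp: e_def)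
  moreover have "S e = 0" using Suc.prems(1) PQ by (simp add: e_def)
  moreover have "S (z - diffop u A y) = 0"
    using A by (simp add: S_def diffop_linear diffop_mult_swap)
  ultimately have "\<exists>c. z - diffop u A y = fls_const c * e"
    using u by (intro rescaled_deriv_eigenvectors_proportional[of u _ \<mu>]) (simp_all add: Seq)
  then obtain c where "z - diffop u A y = fls_const c * e" by blast
  hence "z = diffop u (A + smult c Q) y"
    by (simp add: diffop_add diffop_smult e_def algebra_simps)
  thus ?case by blast
qed

interpretation fls_vec: vector_space "\<lambda>c (x::complex fls). fls_const c * x"
  by unfold_locales (simp_all add: distrib_left distrib_right mult.assoc[symmetric] fls_plus_const[symmetric])

text \<open>
  Membership in some finite-dimensional complex space stable under the derivation. This form is
  easily seen to be closed under products and under solving linear systems; by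
  \<open>deriv_finite_imp_annihilated\<close> below it yields an annihilating polynomial.
\<close>

definition deriv_finite :: "complex fls \<Rightarrow> complex fls \<Rightarrow> bool"
  where "deriv_finite u x \<longleftrightarrow>
    (\<exists>B. finite B \<and> x \<in> fls_vec.span B \<and> rescaled_deriv u ` B \<subseteq> fls_vec.span B)"

lemma rescaled_deriv_span:
  assumes "rescaled_deriv u ` B \<subseteq> fls_vec.span B'" "x \<in> fls_vec.span B" 
  shows "rescaled_deriv u x \<in> fls_vec.span B'"
  using assms(2) 
proof (induction rule: fls_vec.span_induct_alt)
  case base show ?case by (simp add: fls_vec.span_zero)
next
  case (step c x y)
  thus ?case using assms(1) by (auto intro!: fls_vec.span_add fls_vec.span_scale)
qed

text \<open>
  The iterated derivatives of \<open>x\<close> stay in a space of finite dimension, so that finitely many of them are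
  linearly dependent. A repetition among them has to be treated separately, because linear dependence
  is a property of the set of vectors and not of the family.
\<close>

lemma deriv_finite_imp_annihilated:
  assumes "deriv_finite u x"
  shows "\<exists>P. P \<noteq> 0 \<and> diffop u P x = 0"
proof -
  obtain B where B: "finite B" "x \<in> fls_vec.span B" "rescaled_deriv u ` B \<subseteq> fls_vec.span B"
    using assms by (auto simp: deriv_finite_def)
  define d where "d = (\<lambda>i. (rescaled_deriv u ^^ i) x)"
  have d_span: "d i \<in> fls_vec.span B" for i
    by (induction i) (auto simp: d_def B(2) intro: rescaled_deriv_span[OF B(3)])
  show ?thesis
  proof (cases "inj_on d {..card B}")
    case False
    then obtain i j where ij: "i \<noteq> j" "d i = d j" by (auto simp: inj_on_def)
    define P where "P = monom (1::complex) i - monom 1 j"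
    have "coeff P i = 1" using ij by (simp add: P_def)
    hence "P \<noteq> 0" by auto
    moreover have "diffop u (monom 1 k) x = d k" for k
      by (simp add: diffop_def d_def degree_monom_eq if_distrib[of fls_const] if_distrib[of "\<lambda>x. x * _"] cong: if_cong)
    hence "diffop u P x = 0"
      using diffop_add[of u P "monom 1 j" x] ij by (simp add: P_def)
    ultimately show ?thesis by blast
  next
    case True
    have "fls_vec.dependent (d ` {..card B})"
    proof (rule ccontr)
      assume "\<not> ?thesis"
      with fls_vec.independent_span_bound[OF B(1), of "d ` {..card B}"] d_span
      have "card (d ` {..card B}) \<le> card B" by blast
      thus False using True by (simp add: card_image)
    qed
    then obtain c where c: "\<exists>v\<in>d ` {..card B}. c v \<noteq> 0" "(\<Sum>v\<in>d ` {..card B}. fls_const (c v) * v) = 0"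
      unfolding fls_vec.dependent_finite[OF finite_imageI[OF finite_atMost]] by blast
    define P where "P = (\<Sum>i\<le>card B. monom (c (d i)) i)"
    have coeff: "coeff P i = (if i \<le> card B then c (d i) else 0)" for i
      by (simp add: P_def coeff_sum)
    have "degree P \<le> card B"
      by (rule degree_le) (simp add: coeff)
    hence "diffop u P x = (\<Sum>i\<le>card B. fls_const (c (d i)) * d i)"
      by (simp add: diffop_bound coeff d_def)
    also have "\<dots> = 0"
      using c(2) True by (simp add: sum.reindex)
    finally have "diffop u P x = 0" .
    moreover have "P \<noteq> 0"
      using c(1) coeff by (metis (no_types, lifting) imageE atMost_iff coeff_0)
    ultimately show ?thesis by blast
  qed
qed

lemma deriv_finite_const: "deriv_finite u (fls_const c)"
  unfolding deriv_finite_def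
  by (rule exI[of _ "{1}"])
     (use fls_vec.span_scale[OF fls_vec.span_base, of 1 "{1}" c] in
       \<open>auto simp: fls_vec.span_zero rescaled_deriv_def\<close>)

lemma deriv_finite_span:
  assumes "finite I" "\<And>i. i \<in> I \<Longrightarrow> deriv_finite u (g i)"
  shows "\<exists>B. finite B \<and> g ` I \<subseteq> fls_vec.span B \<and> rescaled_deriv u ` B \<subseteq> fls_vec.span B"
proof -
  obtain B where B: "\<And>i. i \<in> I \<Longrightarrow> finite (B i) \<and> g i \<in> fls_vec.span (B i) \<and>
      rescaled_deriv u ` (B i) \<subseteq> fls_vec.span (B i)"
    using assms(2) unfolding deriv_finite_def by metis
  have "fls_vec.span (B i) \<subseteq> fls_vec.span (\<Union>(B ` I))" if "i \<in> I" for i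
    by (rule fls_vec.span_mono) (use that in blast)
  hence "finite (\<Union>(B ` I)) \<and> g ` I \<subseteq> fls_vec.span (\<Union>(B ` I)) \<and>
     rescaled_deriv u ` (\<Union>(B ` I)) \<subseteq> fls_vec.span (\<Union>(B ` I))"
    using B assms(1) by blast
  thus ?thesis by blast
qed

lemma deriv_finite_add:
  assumes "deriv_finite u x" "deriv_finite u y"
  shows "deriv_finite u (x + y)"
proof -
  obtain B where "finite B" "id ` {x, y} \<subseteq> fls_vec.span B" "rescaled_deriv u ` B \<subseteq> fls_vec.span B"
    using deriv_finite_span[of "{x, y}" u id] assms by auto
  thus ?thesis unfolding deriv_finite_def by (auto intro: fls_vec.span_add)
qed

lemma span_mult:
  assumes "x \<in> fls_vec.span A" "y \<in> fls_vec.span B"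
  shows "x * y \<in> fls_vec.span ((\<lambda>(a, b). a * b) ` (A \<times> B))" (is "_ \<in> fls_vec.span ?AB")
  using assms(1)
proof (induction rule: fls_vec.span_induct_alt)
  case base show ?case by (simp add: fls_vec.span_zero)
next
  case (step c a x)
  have "a * y \<in> fls_vec.span ?AB"
    using assms(2)
  proof (induction rule: fls_vec.span_induct_alt)
    case base show ?case by (simp add: fls_vec.span_zero)
  next
    case (step c' b y)
    have "a * b \<in> fls_vec.span ?AB"
      by (rule fls_vec.span_base) (use \<open>a \<in> A\<close> step in force)
    from fls_vec.span_add[OF fls_vec.span_scale[OF this, of c'] step(2)]
    show ?case by (simp add: algebra_simps)
  qed
  from fls_vec.span_add[OF fls_vec.span_scale[OF this, of c] step(2)]
  show ?case by (simp add: algebra_simps)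
qed

lemma deriv_finite_mult:
  assumes "deriv_finite u x" "deriv_finite u y"
  shows "deriv_finite u (x * y)"
proof -
  obtain B where B: "finite B" "id ` {x, y} \<subseteq> fls_vec.span B" "rescaled_deriv u ` B \<subseteq> fls_vec.span B"
    using deriv_finite_span[of "{x, y}" u id] assms by auto
  let ?BB = "(\<lambda>(a, b). a * b) ` (B \<times> B)"
  have "rescaled_deriv u ` ?BB \<subseteq> fls_vec.span ?BB"
    by (auto simp: rescaled_deriv_mult
        intro!: fls_vec.span_add span_mult fls_vec.span_base[of _ B] subsetD[OF B(3) imageI])
  moreover have "x * y \<in> fls_vec.span ?BB" "finite ?BB"
    using B by (auto intro!: span_mult)
  ultimately show ?thesis unfolding deriv_finite_def by blast
qed

text \<open>
  The components of the solution and their first derivatives, together with a stable space for the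
  inhomogeneities, span a stable space.
\<close>

lemma deriv_finite_linear_system:
  fixes w g :: "'i::finite \<Rightarrow> complex fls"
  assumes eq: "\<And>i. rescaled_deriv u (rescaled_deriv u (w i)) = (\<Sum>k\<in>UNIV. fls_const (a i k) * w k) + g i"
    and g: "\<And>i. deriv_finite u (g i)"
  shows "deriv_finite u (w i)"
proof -
  obtain B where B: "finite B" "range g \<subseteq> fls_vec.span B" "rescaled_deriv u ` B \<subseteq> fls_vec.span B"
    using deriv_finite_span[of UNIV u g] g by auto
  define C where "C = B \<union> range w \<union> range (\<lambda>i. rescaled_deriv u (w i))"
  have base: "x \<in> C \<Longrightarrow> x \<in> fls_vec.span C" for x
    by (rule fls_vec.span_base)
  have BC: "fls_vec.span B \<subseteq> fls_vec.span C"
    by (rule fls_vec.span_mono) (auto simp: C_def)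
  have "rescaled_deriv u x \<in> fls_vec.span C" if "x \<in> C" for x
  proof -
    from that consider "x \<in> B" | i where "x = w i" | i where "x = rescaled_deriv u (w i)"
      by (auto simp: C_def)
    thus ?thesis
    proof cases
      case 1
      thus ?thesis using B(3) BC by blast
    next
      case 2
      thus ?thesis by (intro base) (simp add: C_def)
    next
      case (3 i)
      have "(\<Sum>k\<in>UNIV. fls_const (a i k) * w k) + g i \<in> fls_vec.span C"
        by (intro fls_vec.span_add fls_vec.span_sum fls_vec.span_scale base
              subsetD[OF BC] subsetD[OF B(2)]) (auto simp: C_def)
      thus ?thesis by (simp add: 3 eq)
    qed
  qed
  hence "rescaled_deriv u ` C \<subseteq> fls_vec.span C" by blast
  moreover have "w i \<in> fls_vec.span C" by (rule base) (simp add: C_def)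
  moreover have "finite C" using B by (simp add: C_def)
  ultimately show ?thesis unfolding deriv_finite_def by blast
qed

section \<open>Differential Galois groups\<close>

lemma is_subfieldD:
  assumes "is_subfield S"
  shows "0 \<in> S" "1 \<in> S" "x \<in> S \<Longrightarrow> y \<in> S \<Longrightarrow> x - y \<in> S" "x \<in> S \<Longrightarrow> y \<in> S \<Longrightarrow> x * y \<in> S"
    "x \<in> S \<Longrightarrow> inverse x \<in> S" "x \<in> S \<Longrightarrow> y \<in> S \<Longrightarrow> x + y \<in> S" "x \<in> S \<Longrightarrow> y \<in> S \<Longrightarrow> x / y \<in> S"
proof -
  show *: "0 \<in> S" "1 \<in> S" "x \<in> S \<Longrightarrow> y \<in> S \<Longrightarrow> x - y \<in> S" "x \<in> S \<Longrightarrow> y \<in> S \<Longrightarrow> x * y \<in> S"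
    "x \<in> S \<Longrightarrow> inverse x \<in> S" for x y
    using assms by (auto simp: is_subfield_def)
  show "x \<in> S \<Longrightarrow> y \<in> S \<Longrightarrow> x + y \<in> S"
    using *(3)[of x "0 - y"] *(3)[of 0 y] *(1) by simp
  show "x \<in> S \<Longrightarrow> y \<in> S \<Longrightarrow> x / y \<in> S"
    using *(4)[of x "inverse y"] *(5)[of y] by (simp add: divide_inverse)
qed

lemma is_subfield_hull: "is_subfield (is_subfield hull S)"
  by (rule hull_in) (auto simp: is_subfield_def)

lemma is_diff_subfield_hull: "is_diff_subfield D (is_diff_subfield D hull S)"
  by (rule hull_in) (auto simp: is_diff_subfield_def is_subfield_def)

lemma diff_galois_groupD:
  assumes "\<sigma> \<in> carrier (diff_galois_group D K L)"
  shows "\<sigma> \<in> Bij L" "x \<in> L \<Longrightarrow> \<sigma> x \<in> L" "x \<in> L \<Longrightarrow> y \<in> L \<Longrightarrow> \<sigma> (x + y) = \<sigma> x + \<sigma> y"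
    "x \<in> L \<Longrightarrow> y \<in> L \<Longrightarrow> \<sigma> (x * y) = \<sigma> x * \<sigma> y" "x \<in> L \<Longrightarrow> \<sigma> (D x) = D (\<sigma> x)"
    "x \<in> K \<Longrightarrow> \<sigma> x = x"
  using assms Bij_imp_funcset[of \<sigma> L] by (auto simp: diff_galois_group_def)

text \<open>
  The definition of the Galois group mentions sums and products only; the other field operations
  follow from them by injectivity.
\<close>

lemma field_automorphism_minus_inverse:
  assumes L: "is_subfield L" and \<sigma>: "\<sigma> \<in> carrier (diff_galois_group D K L)"
  shows "\<sigma> 0 = 0" "\<sigma> 1 = 1" "x \<in> L \<Longrightarrow> y \<in> L \<Longrightarrow> \<sigma> (x - y) = \<sigma> x - \<sigma> y"
    "x \<in> L \<Longrightarrow> \<sigma> (inverse x) = inverse (\<sigma> x)"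
proof -
  note L = is_subfieldD[OF L] and S = diff_galois_groupD[OF \<sigma>]
  have inj: "inj_on \<sigma> L" using S(1) by (auto simp: Bij_def bij_betw_def)
  show zero: "\<sigma> 0 = 0" using S(3)[OF L(1) L(1)] by (metis add_cancel_right_right)
  have "\<sigma> 1 \<noteq> 0" using inj_onD[OF inj, of 1 0] L(1,2) zero by auto
  thus one: "\<sigma> 1 = 1" using S(4)[of 1 1] L(2) by simp
  show "\<sigma> (x - y) = \<sigma> x - \<sigma> y" if "x \<in> L" "y \<in> L"
    using S(3)[of "x - y" y] L(3) that by simp
  show "\<sigma> (inverse x) = inverse (\<sigma> x)" if "x \<in> L"
  proof (cases "x = 0")
    case False
    have "\<sigma> x * \<sigma> (inverse x) = 1"
      using S(4)[of x "inverse x"] L(5) that False one by simp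
    thus ?thesis by (metis inverse_unique)
  qed (simp add: zero)
qed

lemma group_diff_galois_group:
  assumes L: "is_diff_subfield D L" and K: "K \<subseteq> L"
  shows "group (diff_galois_group D K L)"
proof -
  have L': "is_subfield L" "\<And>x. x \<in> L \<Longrightarrow> D x \<in> L"
    using L by (auto simp: is_diff_subfield_def)
  note L_closed = is_subfieldD[OF L'(1)] L'(2)
  let ?C = "carrier (diff_galois_group D K L)"
  have "subgroup ?C (BijGroup L)"
  proof (rule group.subgroupI[OF group_BijGroup])
    show "?C \<subseteq> carrier (BijGroup L)"
      by (auto simp: diff_galois_group_def BijGroup_def)
    have "(\<lambda>x\<in>L. x) \<in> ?C"
      using K L_closed by (auto simp: diff_galois_group_def id_Bij)
    thus "?C \<noteq> {}" by blast
  next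
    fix \<sigma> assume \<sigma>: "\<sigma> \<in> ?C"
    note S = diff_galois_groupD[OF \<sigma>]
    have inv: "inv_into L \<sigma> y \<in> L" "\<sigma> (inv_into L \<sigma> y) = y" if "y \<in> L" for y
      using S(1) that by (auto simp: Bij_def bij_betw_def inv_into_into f_inv_into_f)
    have inv_eq: "inv_into L \<sigma> y = x" if "x \<in> L" "\<sigma> x = y" for x y
      using S(1) that by (auto simp: Bij_def bij_betw_def inv_into_f_eq)
    have "inv\<^bsub>BijGroup L\<^esub> \<sigma> = (\<lambda>x\<in>L. inv_into L \<sigma> x)"
      by (rule inv_BijGroup) (rule S(1))
    also have "\<dots> \<in> ?C"
      using K by (auto simp: diff_galois_group_def restrict_inv_into_Bij S(1) L_closed inv S
          intro!: inv_eq)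
    finally show "inv\<^bsub>BijGroup L\<^esub> \<sigma> \<in> ?C" .
  next
    fix \<sigma> \<rho> assume \<sigma>: "\<sigma> \<in> ?C" and \<rho>: "\<rho> \<in> ?C"
    note S = diff_galois_groupD[OF \<sigma>] and R = diff_galois_groupD[OF \<rho>]
    have "\<sigma> \<otimes>\<^bsub>BijGroup L\<^esub> \<rho> = compose L \<sigma> \<rho>"
      using S(1) R(1) by (simp add: BijGroup_def)
    also have "\<dots> \<in> ?C"
      using K S R compose_Bij[OF S(1) R(1)]
      by (auto simp: diff_galois_group_def compose_eq L_closed)
    finally show "\<sigma> \<otimes>\<^bsub>BijGroup L\<^esub> \<rho> \<in> ?C" .
  qed
  from subgroup.subgroup_is_group[OF this group_BijGroup] show ?thesis
    by (simp add: diff_galois_group_def)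
qed

lemma comm_group_diff_galois_group:
  assumes L: "is_diff_subfield D L" and K: "K \<subseteq> L"
    and comm: "\<And>\<sigma> \<rho> x. \<sigma> \<in> carrier (diff_galois_group D K L) \<Longrightarrow>
      \<rho> \<in> carrier (diff_galois_group D K L) \<Longrightarrow> x \<in> L \<Longrightarrow> \<sigma> (\<rho> x) = \<rho> (\<sigma> x)"
  shows "comm_group (diff_galois_group D K L)"
proof (rule group.group_comm_groupI[OF group_diff_galois_group[OF L K]])
  fix \<sigma> \<rho>
  assume \<sigma>: "\<sigma> \<in> carrier (diff_galois_group D K L)" and \<rho>: "\<rho> \<in> carrier (diff_galois_group D K L)"
  have "compose L \<sigma> \<rho> = compose L \<rho> \<sigma>"
    using comm[OF \<sigma> \<rho>] by (auto simp: compose_def)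
  thus "\<sigma> \<otimes>\<^bsub>diff_galois_group D K L\<^esub> \<rho> = \<rho> \<otimes>\<^bsub>diff_galois_group D K L\<^esub> \<sigma>"
    using diff_galois_groupD(1)[OF \<sigma>] diff_galois_groupD(1)[OF \<rho>]
    by (simp add: diff_galois_group_def BijGroup_def)
qed

text \<open>
  This reduces the commutation of two automorphisms to generators of the field.
\<close>

lemma commuting_elements_diff_subfield:
  assumes L: "is_diff_subfield D L"
    and \<sigma>: "\<sigma> \<in> carrier (diff_galois_group D K L)" and \<rho>: "\<rho> \<in> carrier (diff_galois_group D K L)"
  shows "is_diff_subfield D {x \<in> L. \<sigma> (\<rho> x) = \<rho> (\<sigma> x)}"
proof -
  have L': "is_subfield L" "\<And>x. x \<in> L \<Longrightarrow> D x \<in> L"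
    using L by (auto simp: is_diff_subfield_def)
  note S = diff_galois_groupD[OF \<sigma>] field_automorphism_minus_inverse[OF L'(1) \<sigma>]
    and R = diff_galois_groupD[OF \<rho>] field_automorphism_minus_inverse[OF L'(1) \<rho>]
  show ?thesis
    unfolding is_diff_subfield_def is_subfield_def
    by (auto simp: is_subfieldD[OF L'(1)] L'(2) S R)
qed

text \<open>
  Each automorphism commutes with the derivation rescaled by \<open>u\<close>, so it preserves the kernel of the
  operator given by the minimal polynomial of \<open>y\<close>. By \<open>diffop_kernel_cyclic\<close> it acts on \<open>y\<close> as a polynomial
  in the derivation. Two such polynomials commute.
\<close>

lemma galois_commute_on_deriv_finite:
  assumes L: "is_diff_subfield fls_deriv L"
    and \<sigma>: "\<sigma> \<in> carrier (diff_galois_group fls_deriv K L)"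
    and \<rho>: "\<rho> \<in> carrier (diff_galois_group fls_deriv K L)"
    and K: "range fls_const \<subseteq> K" "K \<subseteq> L" and u: "u \<in> K" "u \<noteq> 0"
    and y: "y \<in> L" "deriv_finite u y"
  shows "\<sigma> (\<rho> y) = \<rho> (\<sigma> y)"
proof -
  have L': "is_subfield L" "\<And>x. x \<in> L \<Longrightarrow> fls_deriv x \<in> L"
    using L by (auto simp: is_diff_subfield_def)
  have const: "fls_const c \<in> L" "fls_const c \<in> K" for c
    using K by auto
  note L_closed = is_subfieldD[OF L'(1)] L'(2)
  have pow: "(rescaled_deriv u ^^ i) x \<in> L" if "x \<in> L" for i x
    by (induction i) (use that u K in \<open>auto simp: rescaled_deriv_def intro!: L_closed\<close>)
  have diffop_comm: "\<tau> (diffop u P x) = diffop u P (\<tau> x)"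
    if \<tau>: "\<tau> \<in> carrier (diff_galois_group fls_deriv K L)" and x: "x \<in> L" for \<tau> P x
  proof -
    note T = diff_galois_groupD[OF \<tau>] field_automorphism_minus_inverse[OF L'(1) \<tau>]
    have T_pow: "\<tau> ((rescaled_deriv u ^^ i) x) = (rescaled_deriv u ^^ i) (\<tau> x)" for i
    proof (induction i)
      case (Suc i)
      have "\<tau> (u * fls_deriv ((rescaled_deriv u ^^ i) x)) =
          u * fls_deriv (\<tau> ((rescaled_deriv u ^^ i) x))"
        using u K(2) T(4-6) L_closed(8) pow[OF x] by (metis subsetD)
      thus ?case using Suc by (simp add: rescaled_deriv_def[of u "(rescaled_deriv u ^^ i) _"])
    qed simp
    have T_sum: "sum f I \<in> L \<and> \<tau> (sum f I) = (\<Sum>i\<in>I. \<tau> (f i))"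
      if "finite I" "\<And>i. i \<in> I \<Longrightarrow> f i \<in> L" for f and I :: "nat set"
      using that by (induction I rule: finite_induct) (auto simp: T L_closed)
    have "\<tau> (diffop u P x) = (\<Sum>i\<le>degree P. \<tau> (fls_const (coeff P i) * (rescaled_deriv u ^^ i) x))"
      unfolding diffop_def by (rule T_sum[THEN conjunct2]) (auto intro!: L_closed const pow x)
    also have "\<dots> = diffop u P (\<tau> x)"
      by (simp add: diffop_def T(4,6) const pow x T_pow)
    finally show ?thesis .
  qed
  obtain P where P: "P \<noteq> 0" "diffop u P y = 0"
    and P_min: "\<And>Q. diffop u Q y = 0 \<Longrightarrow> Q \<noteq> 0 \<Longrightarrow> degree P \<le> degree Q"
    using ex_has_least_nat[of "\<lambda>P. P \<noteq> 0 \<and> diffop u P y = 0" _ degree]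
      deriv_finite_imp_annihilated[OF y(2)] by blast
  have "\<exists>A. \<tau> y = diffop u A y" if \<tau>: "\<tau> \<in> carrier (diff_galois_group fls_deriv K L)" for \<tau>
  proof (rule diffop_kernel_cyclic[OF u(2) P(2,1) P_min])
    show "diffop u P (\<tau> y) = 0"
      using diffop_comm[OF \<tau> y(1), of P] P(2) field_automorphism_minus_inverse(1)[OF L'(1) \<tau>]
      by simp
  qed
  then obtain A B where "\<sigma> y = diffop u A y" "\<rho> y = diffop u B y"
    using \<sigma> \<rho> by blast
  thus ?thesis
    using diffop_comm[OF \<sigma> y(1)] diffop_comm[OF \<rho> y(1)] diffop_mult_swap by metis
qed

section \<open>Germs as formal Laurent series\<close>

lemma germ_expansion:
  "f analytic_on {t0} \<Longrightarrow> (\<lambda>x. f (t0 + x)) has_fps_expansion fps_expansion f t0"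
  by (rule analytic_at_imp_has_fps_expansion)

lemma germ_eqI:
  assumes "f analytic_on {t0}" "(\<lambda>x. f (t0 + x)) has_fps_expansion F"
  shows "germ t0 f = fps_to_fls F"
  using fps_expansion_unique_complex[OF germ_expansion[OF assms(1)] assms(2)]
  by (simp add: germ_def)

lemma germ_cong: "\<forall>\<^sub>F t in nhds t0. f t = g t \<Longrightarrow> germ t0 f = germ t0 g"
  by (simp add: germ_def fps_expansion_cong)

lemma germ_const: "germ t0 (\<lambda>_. c) = fls_const c"
  using germ_eqI[of "\<lambda>_. c" t0 "fps_const c"] by simp

lemma germ_add:
  assumes "f analytic_on {t0}" "g analytic_on {t0}"
  shows "germ t0 (\<lambda>t. f t + g t) = germ t0 f + germ t0 g"
  using germ_eqI[OF analytic_on_add[OF assms] has_fps_expansion_add[OF assms[THEN germ_expansion]]]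
  by (simp add: germ_def)

lemma germ_mult:
  assumes "f analytic_on {t0}" "g analytic_on {t0}"
  shows "germ t0 (\<lambda>t. f t * g t) = germ t0 f * germ t0 g"
  using germ_eqI[OF analytic_on_mult[OF assms] has_fps_expansion_mult[OF assms[THEN germ_expansion]]]
  by (simp add: germ_def fls_times_fps_to_fls)

lemma germ_sum:
  assumes "\<And>i. i \<in> I \<Longrightarrow> f i analytic_on {t0}" "finite I"
  shows "germ t0 (\<lambda>t. \<Sum>i\<in>I. f i t) = (\<Sum>i\<in>I. germ t0 (f i))"
  using assms(2,1)
  by (induction I rule: finite_induct)
     (simp_all add: germ_add analytic_on_sum germ_const[of _ 0, simplified])

lemma germ_deriv: "germ t0 (deriv f) = fls_deriv (germ t0 f)"
proof -
  have "fps_expansion (deriv f) t0 = fps_deriv (fps_expansion f t0)"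
    by (rule fps_ext)
       (simp add: fps_expansion_def funpow_swap1 field_simps del: of_nat_Suc)
  thus ?thesis by (simp add: germ_def fls_deriv_fps_to_fls)
qed

lemma germ_inverse:
  assumes "f analytic_on {t0}" "f t0 \<noteq> 0"
  shows "germ t0 f \<noteq> 0" "germ t0 (\<lambda>t. inverse (f t)) = inverse (germ t0 f)"
proof -
  have "\<forall>\<^sub>F t in nhds t0. f t \<noteq> 0"
    using analytic_at_imp_isCont[OF assms(1)] assms(2)
    unfolding isCont_def tendsto_at_iff_tendsto_nhds by (rule tendsto_imp_eventually_ne)
  hence "germ t0 (\<lambda>t. f t * inverse (f t)) = germ t0 (\<lambda>t. 1)"
    by (intro germ_cong) (auto elim: eventually_mono)
  hence "germ t0 f * germ t0 (\<lambda>t. inverse (f t)) = 1"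
    using germ_mult[OF assms(1) analytic_on_inverse[OF assms(1)]] assms(2) by (simp add: germ_const)
  thus "germ t0 f \<noteq> 0" "germ t0 (\<lambda>t. inverse (f t)) = inverse (germ t0 f)"
    by (auto simp: inverse_unique)
qed

section \<open>Homogeneity of the force\<close>

text \<open>
  Euler's argument: differentiate \<open>V (c *s q) = c powi k * V q\<close> in each coordinate direction.
\<close>

lemma homogeneous_potential_grad:
  fixes V :: "complex ^ 'n \<Rightarrow> complex"
  assumes V: "homogeneous_potential k U V" and c: "c \<noteq> 0" and q: "q \<in> U"
  shows "grad V (c *s q) = c powi (k - 1) *s grad V q"
proof -
  have hol: "holomorphic_several V U" and U: "open U" "c *s q \<in> U"
    and hom: "\<And>q. q \<in> U \<Longrightarrow> V (c *s q) = c powi k * V q"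
    using V c q by (auto simp: homogeneous_potential_def)
  have "c * grad V (c *s q) $ i = c powi k * grad V q $ i" for i
  proof -
    have axis0: "axis i 0 = (0 :: complex ^ 'n)" by (simp add: vec_eq_iff axis_def)
    have 1: "((\<lambda>h. V (c *s q + axis i (c * h))) has_field_derivative c * grad V (c *s q) $ i) (at 0)"
      using DERIV_chain2[OF has_field_derivative_along_axis[OF hol, of "c *s q" i "c * 0"]
              DERIV_cmult[OF DERIV_ident, of c 0 UNIV]] U
      by (simp add: axis0 mult.commute)
    have 2: "((\<lambda>h. c powi k * V (q + axis i h)) has_field_derivative c powi k * grad V q $ i) (at 0)"
      using DERIV_cmult[OF has_field_derivative_along_axis[OF hol, of q i 0]] q
      by (simp add: axis0)
    have "isCont (\<lambda>h. q + axis i h) 0"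
      by (intro continuous_intros bounded_linear.continuous[OF bounded_linear_axis_complex])
    hence "((\<lambda>h. q + axis i h) \<longlongrightarrow> q + axis i 0) (nhds 0)"
      unfolding isCont_def
      using tendsto_at_iff_tendsto_nhds[of "\<lambda>h. q + axis i h" 0] by blast
    hence "((\<lambda>h. q + axis i h) \<longlongrightarrow> q) (nhds 0)"
      by (simp add: axis0)
    hence "\<forall>\<^sub>F h in nhds 0. q + axis i h \<in> U"
      by (rule topological_tendstoD[OF _ U(1) q])
    hence "\<forall>\<^sub>F h in nhds 0. V (c *s q + axis i (c * h)) = c powi k * V (q + axis i h)"
    proof eventually_elim
      case (elim h)
      have "c *s q + axis i (c * h) = c *s (q + axis i h)"
        by (simp add: vec_eq_iff axis_def algebra_simps)
      thus ?case using hom[OF elim] by simp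
    qed
    from DERIV_cong_ev[OF refl this refl] 1 2 show ?thesis
      using DERIV_unique by blast
  qed
  thus ?thesis
    using c by (simp add: vec_eq_iff power_int_diff field_simps)
qed

lemma holomorphic_several_uminus:
  assumes "holomorphic_several f U"
  shows "holomorphic_several (\<lambda>q. - f q) U"
  using has_derivative_minus[OF holomorphic_several_has_derivative[OF assms]]
  by (intro holomorphic_severalI[where g = "\<lambda>q i. - grad f q $ i"]) (simp add: sum_negf)

lemma holomorphic_several_force:
  assumes "holomorphic_several V U" "open U"
  shows "holomorphic_several (\<lambda>q. force V q $ i) U"
  using holomorphic_several_uminus[OF holomorphic_several_grad[OF assms]] by (simp add: force_def)

lemma force_homogeneous:
  assumes "homogeneous_potential k U V" "c \<noteq> 0" "q \<in> U"
  shows "force V (c *s q) = c powi (k - 1) *s force V q"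
  using homogeneous_potential_grad[OF assms] by (simp add: force_def vec_eq_iff)

section \<open>The variational equations along a Taylor curve\<close>

text \<open>
  The perturbed solution, in the rescaled variable, as a curve in the formal parameter.
\<close>

definition taylor_curve :: "complex ^ 'n \<Rightarrow> nat \<Rightarrow> (nat \<Rightarrow> complex ^ 'n) \<Rightarrow> complex \<Rightarrow> complex ^ 'n"
  where "taylor_curve d p w \<epsilon> = d + (\<Sum>m=1..p. (\<epsilon> ^ m / fact m) *s w m)"

lemma taylor_curve_0 [simp]: "taylor_curve d p w 0 = d"
  by (simp add: taylor_curve_def vec_eq_iff) (auto intro!: sum.neutral)

text \<open>
  The factorials in the curve are chosen so that its derivatives at \<open>0\<close> are exactly the unknowns.
\<close>

lemma higher_deriv_taylor_curve:
  assumes "1 \<le> m" "m \<le> p"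
  shows "(deriv ^^ m) (\<lambda>\<epsilon>. taylor_curve d p w \<epsilon> $ i) 0 = w m $ i"
proof -
  have "(\<lambda>\<epsilon>. d $ i + (\<Sum>m=1..p. w m $ i / fact m * \<epsilon> ^ m)) has_fps_expansion
      fps_const (d $ i) + (\<Sum>m=1..p. fps_const (w m $ i / fact m) * fps_X ^ m)"
    by (intro fps_expansion_intros)
  also have "(\<lambda>\<epsilon>. d $ i + (\<Sum>m=1..p. w m $ i / fact m * \<epsilon> ^ m)) = (\<lambda>\<epsilon>. taylor_curve d p w \<epsilon> $ i)"
    by (simp add: taylor_curve_def fun_eq_iff mult_ac)
  finally have "fps_nth (fps_const (d $ i) + (\<Sum>m=1..p. fps_const (w m $ i / fact m) * fps_X ^ m)) m =
      (deriv ^^ m) (\<lambda>\<epsilon>. taylor_curve d p w \<epsilon> $ i) 0 / fact m"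
    by (rule fps_nth_fps_expansion)
  also have "fps_nth (fps_const (d $ i) + (\<Sum>m=1..p. fps_const (w m $ i / fact m) * fps_X ^ m)) m =
      (\<Sum>l=1..p. w l $ i * (if m = l then 1 else 0) / fact l)"
    using assms by (simp add: fps_sum_nth)
  also have "\<dots> = (\<Sum>l=1..p. if l = m then w m $ i / fact m else 0)"
    by (intro sum.cong) auto
  also have "\<dots> = w m $ i / fact m"
    using assms by simp
  finally show ?thesis by simp
qed

lemma holomorphic_curve_taylor_curve:
  assumes "open U"
  shows "holomorphic_curve {\<epsilon>. taylor_curve d p w \<epsilon> \<in> U} (taylor_curve d p w) U"
proof -
  have "continuous_on UNIV (\<lambda>\<epsilon>. \<chi> i. d $ i + (\<Sum>m=1..p. \<epsilon> ^ m / fact m * w m $ i))"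
    by (intro continuous_intros) auto
  also have "(\<lambda>\<epsilon>. \<chi> i. d $ i + (\<Sum>m=1..p. \<epsilon> ^ m / fact m * w m $ i)) = taylor_curve d p w"
    by (simp add: taylor_curve_def fun_eq_iff vec_eq_iff)
  finally have "open (taylor_curve d p w -` U)"
    using assms by (simp add: continuous_on_open_vimage)
  moreover have "taylor_curve d p w -` U = {\<epsilon>. taylor_curve d p w \<epsilon> \<in> U}" by auto
  moreover have "(\<lambda>\<epsilon>. taylor_curve d p w \<epsilon> $ i) holomorphic_on A" for i A
    by (auto simp: taylor_curve_def intro!: holomorphic_intros)
  ultimately show ?thesis by (auto simp: holomorphic_curve_def)
qed

text \<open>
  At parameter \<open>0\<close> all curves pass through \<open>d\<close>, so the coefficients of a jet polynomial become complex
  constants, and what remains is a polynomial in the unknowns of order less than \<open>j\<close>.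
\<close>

lemma jet_polynomial_deriv_finite:
  fixes d :: "complex ^ 'n" and w :: "nat \<Rightarrow> complex \<Rightarrow> complex ^ 'n"
  assumes "G \<in> jet_polynomials U j" and "j \<le> p"
    and w: "\<And>m i. 1 \<le> m \<Longrightarrow> m < j \<Longrightarrow>
        (\<lambda>t. w m t $ i) analytic_on {t0} \<and> deriv_finite u (germ t0 (\<lambda>t. w m t $ i))"
  defines "c \<equiv> \<lambda>t. taylor_curve d p (\<lambda>m. w m t)"
  shows "(\<lambda>t. G (c t) 0) analytic_on {t0} \<and> deriv_finite u (germ t0 (\<lambda>t. G (c t) 0))"
  using assms(1)
proof induction
  case (coefficient f)
  show ?case by (simp add: c_def germ_const deriv_finite_const)
next
  case (jet m i)
  thus ?case using w[of m i] assms(2) by (simp add: c_def higher_deriv_taylor_curve)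
next
  case (add G H)
  thus ?case by (auto simp: germ_add intro: analytic_on_add deriv_finite_add)
next
  case (mult G H)
  thus ?case by (auto simp: germ_mult intro: analytic_on_mult deriv_finite_mult)
qed

section \<open>Reduction to constant coefficients\<close>

text \<open>
  The second derivative of \<open>W\<close> in the new time; the terms with the first derivative of \<open>W\<close> cancel for
  the rescaling factor \<open>\<Phi>\<^sup>2\<close>.
\<close>

lemma rescaled_deriv_twice:
  "rescaled_deriv (\<Phi>\<^sup>2) (rescaled_deriv (\<Phi>\<^sup>2) W) =
     \<Phi> ^ 3 * (fls_deriv (fls_deriv (\<Phi> * W)) - W * fls_deriv (fls_deriv \<Phi>))"
  by (simp add: rescaled_deriv_def power2_eq_square power3_eq_cube algebra_simps)

text \<open>
  By homogeneity the factor \<open>\<phi> t\<close> can be taken out of the argument of the force, and only the powers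
  of \<open>\<phi>\<close> in front depend on time explicitly. The functional \<open>G\<close> is chosen before \<open>\<phi>\<close>, \<open>q\<close> and \<open>t\<close>, which
  expresses that the remaining coefficients are constant.
\<close>

lemma variational_rhs_rescaled:
  fixes V :: "complex ^ 'n \<Rightarrow> complex"
  assumes V: "homogeneous_potential k U V" and d: "d \<in> U" and j: "1 \<le> j" "j \<le> p"
  shows "\<exists>G\<in>jet_polynomials U j. \<forall>\<phi> q t. \<phi> t \<noteq> 0 \<longrightarrow>
     variational_rhs (force V) (\<lambda>t. \<phi> t *s d) p q j t $ i =
       \<phi> t powi (k - 1) *
         ((\<Sum>l\<in>UNIV. grad (\<lambda>q. force V q $ i) d $ l * (q j t $ l / \<phi> t)) +
          G (taylor_curve d p (\<lambda>m. inverse (\<phi> t) *s q m t)) 0)"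
proof -
  have U: "open U" and hol: "holomorphic_several V U"
    using V by (auto simp: homogeneous_potential_def)
  define f where "f = (\<lambda>q. force V q $ i)"
  have f: "holomorphic_several f U"
    unfolding f_def by (rule holomorphic_several_force[OF hol U])
  obtain G where G: "G \<in> jet_polynomials U j" and
    G_eq: "\<And>S c \<epsilon>. holomorphic_curve S c U \<Longrightarrow> \<epsilon> \<in> S \<Longrightarrow> (deriv ^^ j) (\<lambda>s. f (c s)) \<epsilon> =
      (\<Sum>l\<in>UNIV. grad f (c \<epsilon>) $ l * (deriv ^^ j) (\<lambda>s. c s $ l) \<epsilon>) + G c \<epsilon>"
    using higher_deriv_along_curve[OF f U j(1)] by blast
  show ?thesis
  proof (rule bexI[OF _ G], intro allI impI)
    fix \<phi> :: "complex \<Rightarrow> complex" and q :: "nat \<Rightarrow> complex \<Rightarrow> complex ^ 'n" and t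
    assume \<phi>: "\<phi> t \<noteq> 0"
    define c where "c = taylor_curve d p (\<lambda>m. inverse (\<phi> t) *s q m t)"
    define S where "S = {\<epsilon>. c \<epsilon> \<in> U}"
    have c: "holomorphic_curve S c U"
      unfolding S_def c_def by (rule holomorphic_curve_taylor_curve[OF U])
    have S: "open S" "0 \<in> S"
      using c d by (auto simp: holomorphic_curve_def S_def c_def)
    have arg: "\<phi> t *s d + (\<Sum>m=1..p. (\<epsilon> ^ m / fact m) *s q m t) = \<phi> t *s c \<epsilon>" for \<epsilon>
    proof -
      have "\<phi> t * (inverse (\<phi> t) * z) = z" for z
        using \<phi> by simp
      note cancel = this
      show ?thesis
        by (simp add: c_def taylor_curve_def vec_eq_iff algebra_simps sum_distrib_left cancel)
    qed
    have "variational_rhs (force V) (\<lambda>t. \<phi> t *s d) p q j t $ i =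
        (deriv ^^ j) (\<lambda>\<epsilon>. force V (\<phi> t *s c \<epsilon>) $ i) 0"
      by (simp only: variational_rhs_def arg vec_lambda_beta)
    also have "\<dots> = (deriv ^^ j) (\<lambda>\<epsilon>. \<phi> t powi (k - 1) * f (c \<epsilon>)) 0"
    proof (rule higher_deriv_cong_ev[OF _ refl])
      show "\<forall>\<^sub>F \<epsilon> in nhds 0. force V (\<phi> t *s c \<epsilon>) $ i = \<phi> t powi (k - 1) * f (c \<epsilon>)"
        using eventually_nhds_in_open[OF S]
        by eventually_elim (simp add: S_def f_def force_homogeneous[OF V \<phi>])
    qed
    also have "\<dots> = \<phi> t powi (k - 1) * (deriv ^^ j) (\<lambda>\<epsilon>. f (c \<epsilon>)) 0"
    proof (rule higher_deriv_cmult[OF _ S(2,1)])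
      show "(\<lambda>\<epsilon>. f (c \<epsilon>)) holomorphic_on S"
        unfolding holomorphic_on_open[OF S(1)]
        using has_field_derivative_along_curve[OF f c] by blast
    qed
    also have "(deriv ^^ j) (\<lambda>\<epsilon>. f (c \<epsilon>)) 0 =
        (\<Sum>l\<in>UNIV. grad f d $ l * (q j t $ l / \<phi> t)) + G c 0"
      unfolding G_eq[OF c S(2)] unfolding c_def higher_deriv_taylor_curve[OF j]
      by (simp add: divide_inverse mult.commute)
    finally show "variational_rhs (force V) (\<lambda>t. \<phi> t *s d) p q j t $ i =
       \<phi> t powi (k - 1) *
         ((\<Sum>l\<in>UNIV. grad (\<lambda>q. force V q $ i) d $ l * (q j t $ l / \<phi> t)) +
          G (taylor_curve d p (\<lambda>m. inverse (\<phi> t) *s q m t)) 0)"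
      by (simp add: f_def c_def)
  qed
qed

text \<open>
  The exponent \<open>-3\<close> of the force is exactly cancelled by the factor \<open>\<Phi> ^ 3\<close> in \<open>rescaled_deriv_twice\<close>, and
  the equation for \<open>\<phi>\<close> contributes the constant multiple \<open>\<gamma>\<close> of the unknown. So the rescaled unknowns of
  order \<open>j\<close> satisfy a linear system with constant coefficients, with an inhomogeneity from the lower
  orders that is covered by the induction hypothesis.
\<close>

lemma VE_solution_deriv_finite:
  fixes V :: "complex ^ 'n \<Rightarrow> complex"
  assumes V: "homogeneous_potential (-2) U V" and d: "d \<in> U"
    and \<phi>: "phase_curve_function (-2) \<gamma> e T \<phi>" and t0: "t0 \<in> T"
    and q: "VE_solution (force V) (\<lambda>t. \<phi> t *s d) p t0 q"
    and j: "1 \<le> j" "j \<le> p"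
  shows "deriv_finite ((germ t0 \<phi>)\<^sup>2) (germ t0 (\<lambda>t. q j t $ i) / germ t0 \<phi>)"
proof -
  define \<Phi> where "\<Phi> = germ t0 \<phi>"
  define \<psi> where "\<psi> = (\<lambda>t. inverse (\<phi> t))"
  define w where "w = (\<lambda>m t. \<psi> t *s q m t)"
  define W where "W = (\<lambda>m l. germ t0 (\<lambda>t. w m t $ l))"
  have T: "open T" and \<phi>0: "\<And>t. t \<in> T \<Longrightarrow> \<phi> t \<noteq> 0"
    and \<phi>_ode: "\<And>t. t \<in> T \<Longrightarrow> deriv (deriv \<phi>) t = - \<gamma> * \<phi> t powi (- 3)"
    and \<phi>_an: "\<phi> analytic_on {t0}"
    using \<phi> t0 by (auto simp: phase_curve_function_def analytic_at)
  have in_T: "\<forall>\<^sub>F t in nhds t0. t \<in> T"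
    by (rule eventually_nhds_in_open[OF T t0])
  have \<psi>_an: "\<psi> analytic_on {t0}"
    unfolding \<psi>_def using \<phi>0[OF t0] by (intro analytic_intros \<phi>_an) auto
  have \<Phi>0: "\<Phi> \<noteq> 0" and germ_\<psi>: "germ t0 \<psi> = inverse \<Phi>"
    using germ_inverse[OF \<phi>_an \<phi>0[OF t0]] by (auto simp: \<Phi>_def \<psi>_def)
  have powi: "\<phi> t powi (- 3) = \<psi> t * \<psi> t * \<psi> t" for t
    by (simp add: \<psi>_def power_int_minus power3_eq_cube)
  have germ_powi: "germ t0 (\<lambda>t. \<psi> t * \<psi> t * \<psi> t * g t) = inverse \<Phi> ^ 3 * germ t0 g"
    if "g analytic_on {t0}" for g
    using that by (simp add: germ_mult analytic_on_mult \<psi>_an germ_\<psi> power3_eq_cube)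
  have \<Phi>_ode: "fls_deriv (fls_deriv \<Phi>) = inverse \<Phi> ^ 3 * fls_const (- \<gamma>)"
  proof -
    have "germ t0 (deriv (deriv \<phi>)) = germ t0 (\<lambda>t. \<psi> t * \<psi> t * \<psi> t * (- \<gamma>))"
      by (intro germ_cong eventually_mono[OF in_T]) (simp add: \<phi>_ode powi)
    also have "\<dots> = inverse \<Phi> ^ 3 * germ t0 (\<lambda>_. - \<gamma>)"
      by (rule germ_powi) (rule analytic_on_const)
    finally show ?thesis by (simp only: germ_deriv \<Phi>_def germ_const)
  qed
  have q_an: "(\<lambda>t. q m t $ l) analytic_on {t0}" if "1 \<le> m" "m \<le> p" for m l
    using q that by (simp add: VE_solution_def)
  have w_an: "(\<lambda>t. w m t $ l) analytic_on {t0}" if "1 \<le> m" "m \<le> p" for m l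
    using analytic_on_mult[OF \<psi>_an q_an[OF that]] by (simp add: w_def)
  have W_eq: "W m l = germ t0 (\<lambda>t. q m t $ l) / \<Phi>" if "1 \<le> m" "m \<le> p" for m l
    using germ_mult[OF \<psi>_an q_an[OF that]] by (simp add: W_def w_def germ_\<psi> divide_inverse mult.commute)
  have "deriv_finite (\<Phi>\<^sup>2) (W j i)"
    using j
  proof (induction j arbitrary: i rule: less_induct)
    case (less j)
    define represents where "represents = (\<lambda>i G. \<forall>t. \<phi> t \<noteq> 0 \<longrightarrow>
        variational_rhs (force V) (\<lambda>t. \<phi> t *s d) p q j t $ i = \<phi> t powi (- 3) *
         ((\<Sum>l\<in>UNIV. grad (\<lambda>q. force V q $ i) d $ l * w j t $ l) +
          G (taylor_curve d p (\<lambda>m. w m t)) (0 :: complex)))"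
    have "\<exists>G\<in>jet_polynomials U j. represents i G" for i
    proof -
      have "w j t $ l = q j t $ l / \<phi> t" for t l
        by (simp add: w_def \<psi>_def divide_inverse mult.commute)
      moreover have "(\<lambda>m. inverse (\<phi> t) *s q m t) = (\<lambda>m. w m t)" for t
        by (simp add: w_def \<psi>_def)
      ultimately show ?thesis
        using variational_rhs_rescaled[OF V d less.prems, of i]
        unfolding represents_def by (elim bexE) (rule bexI, simp_all)
    qed
    then obtain G where G: "\<And>i. G i \<in> jet_polynomials U j" and "\<And>i. represents i (G i)"
      by metis
    hence rhs: "variational_rhs (force V) (\<lambda>t. \<phi> t *s d) p q j t $ i = \<phi> t powi (- 3) *
         ((\<Sum>l\<in>UNIV. grad (\<lambda>q. force V q $ i) d $ l * w j t $ l) +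
          G i (taylor_curve d p (\<lambda>m. w m t)) 0)" if "\<phi> t \<noteq> 0" for i t
      using that unfolding represents_def by blast
    define g where "g = (\<lambda>i t. G i (taylor_curve d p (\<lambda>m. w m t)) 0)"
    have g: "g i analytic_on {t0} \<and> deriv_finite (\<Phi>\<^sup>2) (germ t0 (g i))" for i
      unfolding g_def
    proof (rule jet_polynomial_deriv_finite[OF G less.prems(2)])
      fix m l assume "1 \<le> m" "m < j"
      thus "(\<lambda>t. w m t $ l) analytic_on {t0} \<and> deriv_finite (\<Phi>\<^sup>2) (germ t0 (\<lambda>t. w m t $ l))"
        using less.IH[of m l] less.prems w_an[of m l] by (simp add: W_def)
    qed
    \<comment> \<open>The matrix of the linearisation of \<open>w'' = F w + \<gamma> w\<close> at \<open>d\<close>.\<close>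
    define a where "a = (\<lambda>i l. grad (\<lambda>q. force V q $ i) d $ l + (if l = i then \<gamma> else 0))"
    have "rescaled_deriv (\<Phi>\<^sup>2) (rescaled_deriv (\<Phi>\<^sup>2) (W j i)) =
        (\<Sum>l\<in>UNIV. fls_const (a i l) * W j l) + germ t0 (g i)" for i
    proof -
      let ?R = "\<lambda>t. (\<Sum>l\<in>UNIV. grad (\<lambda>q. force V q $ i) d $ l * w j t $ l) + g i t"
      have R_an: "?R analytic_on {t0}"
        using g w_an[OF less.prems] by (intro analytic_intros) auto
      have R_germ: "germ t0 ?R =
          (\<Sum>l\<in>UNIV. fls_const (grad (\<lambda>q. force V q $ i) d $ l) * W j l) + germ t0 (g i)"
        using g w_an[OF less.prems]
        by (simp add: germ_add germ_sum germ_mult germ_const analytic_on_sum analytic_on_mult W_def)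
      have "\<forall>\<^sub>F t in nhds t0. deriv (deriv (\<lambda>s. q j s $ i)) t =
          variational_rhs (force V) (\<lambda>t. \<phi> t *s d) p q j t $ i"
        using q less.prems by (simp add: VE_solution_def)
      hence "\<forall>\<^sub>F t in nhds t0. deriv (deriv (\<lambda>s. q j s $ i)) t = \<psi> t * \<psi> t * \<psi> t * ?R t"
        using in_T by eventually_elim (simp add: rhs \<phi>0 powi g_def)
      hence "germ t0 (deriv (deriv (\<lambda>s. q j s $ i))) = inverse \<Phi> ^ 3 * germ t0 ?R"
        by (subst germ_powi[OF R_an, symmetric]) (rule germ_cong)
      moreover have "germ t0 (\<lambda>s. q j s $ i) = \<Phi> * W j i"
        using W_eq[OF less.prems] \<Phi>0 by simp
      ultimately have "fls_deriv (fls_deriv (\<Phi> * W j i)) = inverse \<Phi> ^ 3 * germ t0 ?R"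
        by (simp only: germ_deriv)
      hence "rescaled_deriv (\<Phi>\<^sup>2) (rescaled_deriv (\<Phi>\<^sup>2) (W j i)) =
          \<Phi> ^ 3 * inverse \<Phi> ^ 3 * (germ t0 ?R + fls_const \<gamma> * W j i)"
        unfolding rescaled_deriv_twice \<Phi>_ode by (simp add: algebra_simps)
      also have "\<Phi> ^ 3 * inverse \<Phi> ^ 3 = 1"
        using \<Phi>0 by (simp add: power_mult_distrib[symmetric])
      also have "fls_const \<gamma> * W j i = (\<Sum>l\<in>UNIV. fls_const (if l = i then \<gamma> else 0) * W j l)"
        by (simp add: if_distrib[of fls_const] if_distrib[of "\<lambda>x. x * _"] cong: if_cong)
      finally show ?thesis
        by (simp add: R_germ a_def fls_plus_const[symmetric] distrib_right sum.distrib)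
    qed
    thus ?case using g by (intro deriv_finite_linear_system[of "\<Phi>\<^sup>2" "W j" a "\<lambda>i. germ t0 (g i)"]) auto
  qed
  thus ?thesis using W_eq[OF j] by (simp add: \<Phi>_def)
qed

theorem theorem1p3:
  fixes U :: "(complex ^ 'n) set" and V :: "complex ^ 'n \<Rightarrow> complex"
    and d :: "complex ^ 'n" and \<gamma> e t0 :: complex
    and T :: "complex set" and \<phi> :: "complex \<Rightarrow> complex" and p :: nat
  assumes "homogeneous_potential (-2) U V"
    and "proper_darboux_point U V \<gamma> d"
    and "phase_curve_function (-2) \<gamma> e T \<phi>"
    and "t0 \<in> T"
    and "p \<ge> 1"
  shows "comm_group
           (diff_galois_group fls_deriv (ground_field t0 \<phi>) (PV_field (force V) d \<phi> p t0))"
proof -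
  define K where "K = ground_field t0 \<phi>"
  define L where "L = PV_field (force V) d \<phi> p t0"
  define \<Phi> where "\<Phi> = germ t0 \<phi>"
  define X where "X = {germ t0 (\<lambda>t. q j t $ i) | q j i.
    VE_solution (force V) (\<lambda>t. \<phi> t *s d) p t0 q \<and> j \<in> {1..p}}"
  have L_hull: "L = is_diff_subfield fls_deriv hull (K \<union> X)"
    by (simp add: L_def K_def X_def PV_field_def)
  have L: "is_diff_subfield fls_deriv L"
    unfolding L_hull by (rule is_diff_subfield_hull)
  have KL: "K \<subseteq> L" and XL: "X \<subseteq> L"
    unfolding L_hull by (auto intro: hull_inc)
  have K: "is_subfield K" "range fls_const \<subseteq> K" "\<Phi> \<in> K"
    by (auto simp: K_def ground_field_def \<Phi>_def is_subfield_hull intro: hull_inc)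
  have "\<phi> analytic_on {t0}" "\<phi> t0 \<noteq> 0"
    using assms(3,4) by (auto simp: phase_curve_function_def analytic_at)
  hence \<Phi>0: "\<Phi> \<noteq> 0"
    by (auto simp: \<Phi>_def dest: germ_inverse(1))
  have d: "d \<in> U" using assms(2) by (simp add: proper_darboux_point_def)
  have "comm_group (diff_galois_group fls_deriv K L)"
  proof (rule comm_group_diff_galois_group[OF L KL])
    fix \<sigma> \<rho> x
    assume \<sigma>: "\<sigma> \<in> carrier (diff_galois_group fls_deriv K L)"
      and \<rho>: "\<rho> \<in> carrier (diff_galois_group fls_deriv K L)" and x: "x \<in> L"
    define E where "E = {x \<in> L. \<sigma> (\<rho> x) = \<rho> (\<sigma> x)}"
    have E: "is_diff_subfield fls_deriv E"
      unfolding E_def by (rule commuting_elements_diff_subfield[OF L \<sigma> \<rho>])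
    have KE: "K \<subseteq> E"
      using KL by (auto simp: E_def diff_galois_groupD(6)[OF \<sigma>] diff_galois_groupD(6)[OF \<rho>])
    have "y \<in> E" if "y \<in> X" for y
    proof -
      from that obtain q j i where q: "VE_solution (force V) (\<lambda>t. \<phi> t *s d) p t0 q" "1 \<le> j" "j \<le> p"
        and y: "y = germ t0 (\<lambda>t. q j t $ i)"
        by (auto simp: X_def)
      \<comment> \<open>Only the rescaled unknown satisfies a constant-coefficient equation; the factor \<open>\<Phi>\<close> is fixed
        by both automorphisms.\<close>
      have yL: "y / \<Phi> \<in> L"
        using L that XL KL K(3) by (intro is_subfieldD) (auto simp: is_diff_subfield_def)
      have "deriv_finite (\<Phi>\<^sup>2) (y / \<Phi>)"
        unfolding y \<Phi>_def by (rule VE_solution_deriv_finite[OF assms(1) d assms(3,4) q])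
      hence "\<sigma> (\<rho> (y / \<Phi>)) = \<rho> (\<sigma> (y / \<Phi>))"
        using \<Phi>0 yL is_subfieldD(4)[OF K(1) K(3) K(3)]
        by (intro galois_commute_on_deriv_finite[OF L \<sigma> \<rho> K(2) KL, of "\<Phi>\<^sup>2"])
           (simp_all add: power2_eq_square)
      hence "y / \<Phi> \<in> E" using yL by (simp add: E_def)
      moreover have "\<Phi> \<in> E" using K(3) KE by blast
      ultimately have "\<Phi> * (y / \<Phi>) \<in> E"
        using E is_subfieldD(4)[of E \<Phi> "y / \<Phi>"] by (simp add: is_diff_subfield_def)
      thus ?thesis using \<Phi>0 by simp
    qed
    hence "L \<subseteq> E"
      unfolding L_hull using KE E by (intro hull_minimal) auto
    thus "\<sigma> (\<rho> x) = \<rho> (\<sigma> x)" using x by (auto simp: E_def)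
  qed
  thus ?thesis by (simp add: K_def L_def)
qed

end
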